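(* Let $G$ and $H$ be vertex-disjoint finite simple graphs. If both polynomials $\tau_G(x)$ and $\tau_H(x)$ have only real zeros, then $\tau_{G\vee H}(x)$ has only real zeros.
   Context: All graphs are finite and simple. For $i\ge 1$ let $\langle x\rangle_i=x(x+1)\cdots(x+i-1)$ be the rising factorial, and $\langle x\rangle_0=1$. For a graph $G$ with $n$ vertices, let $\chi_G(x)$ be its chromatic polynomial (monic of degree $n$). There are unique coefficients $c_i(G)$ such that $$\chi_G(x)=\sum_{i=0}^{n}(-1)^{n-i}c_i(G)\langle x\rangle_i .$$ The $\tau$-polynomial of $G$ is $\tau_G(x)=\sum_{i=0}^{n}c_i(G)x^i$. The join $G\vee H$ of two vertex-disjoint graphs $G$ and $H$ is the graph obtained from their disjoint union by adding every edge between $V(G)$ and $V(H)$. "Has only real zeros" means that every complex zero of the polynomial is real. *)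

theory Defs
  imports
    "HOL-Analysis.Analysis"
    "HOL-Computational_Algebra.Computational_Algebra"
    "Graph_Theory.Pair_Digraph"
begin

text \<open>
  A finite simple graph is an element of the locale \<^locale>\<open>pair_graph\<close>: a finite vertex set
  with a symmetric irreflexive set of arcs, each undirected edge being represented by its
  two orientations. The graph without vertices is allowed.
\<close>

definition graph_join :: "'a pair_pre_digraph \<Rightarrow> 'a pair_pre_digraph \<Rightarrow> 'a pair_pre_digraph" where
  "graph_join G H =
     \<lparr> pverts = pverts G \<union> pverts H,
       parcs = parcs G \<union> parcs H \<union> pverts G \<times> pverts H \<union> pverts H \<times> pverts G \<rparr>"

definition proper_colorings :: "'a pair_pre_digraph \<Rightarrow> nat \<Rightarrow> ('a \<Rightarrow> nat) set" where
  "proper_colorings G k =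
     {f \<in> pverts G \<rightarrow>\<^sub>E {..<k}. \<forall>(u, v) \<in> parcs G. f u \<noteq> f v}"

definition chromatic_poly :: "'a pair_pre_digraph \<Rightarrow> real poly" where
  "chromatic_poly G =
     (THE p. \<forall>k. poly p (of_nat k) = of_nat (card (proper_colorings G k)))"

text \<open>
  Here \<^term>\<open>pochhammer [:0, 1:] i\<close> is the rising factorial \<open>x (x + 1) \<dots> (x + i - 1)\<close>
  as a polynomial in \<open>x\<close>; the first conjunct pins down the values \<open>c i\<close> for \<open>i > n\<close>,
  which play no role.
\<close>

definition tau_coeff :: "'a pair_pre_digraph \<Rightarrow> nat \<Rightarrow> real" where
  "tau_coeff G =
     (THE c. (\<forall>i > card (pverts G). c i = 0) \<and>
        chromatic_poly G =
          (\<Sum>i\<le>card (pverts G).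
             smult ((-1) ^ (card (pverts G) - i) * c i) (pochhammer [:0, 1:] i)))"

definition tau_poly :: "'a pair_pre_digraph \<Rightarrow> real poly" where
  "tau_poly G = (\<Sum>i\<le>card (pverts G). monom (tau_coeff G i) i)"

definition only_real_zeros :: "real poly \<Rightarrow> bool" where
  "only_real_zeros p \<longleftrightarrow> (\<forall>z::complex. poly (map_poly of_real p) z = 0 \<longrightarrow> z \<in> \<real>)"

text \<open>The join is a graph, and the definite descriptions above are well defined.\<close>

lemma pair_graph_graph_join:
  assumes "pair_graph G" "pair_graph H" "pverts G \<inter> pverts H = {}"
  shows "pair_graph (graph_join G H)"
proof -
  interpret G: pair_graph G by fact
  interpret H: pair_graph H by fact
  have sG: "sym (parcs G)" and sH: "sym (parcs H)"
    using G.pair_sym_arcs H.pair_sym_arcs by (simp_all add: symmetric_def)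
  have s: "sym (parcs (graph_join G H))"
    using sG sH by (auto simp: sym_def graph_join_def)
  show ?thesis
  proof unfold_locales
    fix e assume e: "e \<in> parcs (graph_join G H)"
    show "fst e \<in> pverts (graph_join G H)" "snd e \<in> pverts (graph_join G H)"
      using e G.arc_fst_in_verts G.arc_snd_in_verts H.arc_fst_in_verts H.arc_snd_in_verts
      by (auto simp: graph_join_def)
    show "fst e \<noteq> snd e"
      using e G.pair_no_loops H.pair_no_loops assms(3) by (fastforce simp: graph_join_def)
  next
    show "finite (pverts (graph_join G H))" "finite (parcs (graph_join G H))"
      using G.pair_finite_verts H.pair_finite_verts G.pair_finite_arcs H.pair_finite_arcs
      by (simp_all add: graph_join_def)
    show "symmetric (with_proj (graph_join G H))"
      using s by (simp add: symmetric_def)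
  qed
qed

definition onto_colorings :: "'a pair_pre_digraph \<Rightarrow> nat set \<Rightarrow> ('a \<Rightarrow> nat) set" where
  "onto_colorings G S =
     {f \<in> pverts G \<rightarrow>\<^sub>E S. f ` pverts G = S \<and> (\<forall>(u, v) \<in> parcs G. f u \<noteq> f v)}"

lemma card_onto_colorings_le:
  assumes "pair_graph G" "finite S" "finite T" "card S = card T"
  shows "card (onto_colorings G S) \<le> card (onto_colorings G T)"
proof -
  interpret G: pair_graph G by fact
  obtain h where h: "bij_betw h S T" using assms finite_same_card_bij by blast
  let ?F = "\<lambda>f. restrict (h \<circ> f) (pverts G)"
  show ?thesis
  proof (rule card_inj_on_le[of ?F])
    show "inj_on ?F (onto_colorings G S)"
    proof (rule inj_onI)
      fix f g assume f: "f \<in> onto_colorings G S" and g: "g \<in> onto_colorings G S"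
        and eq: "?F f = ?F g"
      have "f v = g v" if v: "v \<in> pverts G" for v
      proof -
        have "h (f v) = h (g v)" using fun_cong[OF eq, of v] v by simp
        moreover have "f v \<in> S" "g v \<in> S" using f g v by (auto simp: onto_colorings_def)
        ultimately show ?thesis using h by (meson bij_betw_def inj_onD)
      qed
      then show "f = g"
        using f g by (auto simp: onto_colorings_def intro!: PiE_ext[of f "pverts G" "\<lambda>_. S" g])
    qed
    show "?F ` onto_colorings G S \<subseteq> onto_colorings G T"
    proof
      fix y assume "y \<in> ?F ` onto_colorings G S"
      then obtain f where f: "f \<in> onto_colorings G S" and y: "y = ?F f" by blast
      have fS: "f ` pverts G = S" using f by (simp add: onto_colorings_def)
      have yT: "y ` pverts G = T" using fS h y
        by (metis bij_betw_imp_surj_on image_comp image_restrict_eq)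
      have "y u \<noteq> y v" if e: "(u, v) \<in> parcs G" for u v
      proof -
        have uv: "u \<in> pverts G" "v \<in> pverts G" using G.wellformed' e by auto
        moreover have "f u \<noteq> f v" using f e by (auto simp: onto_colorings_def)
        ultimately have "h (f u) \<noteq> h (f v)" using h fS
          by (metis bij_betw_def imageI inj_onD)
        then show ?thesis using uv y by simp
      qed
      moreover have "y \<in> pverts G \<rightarrow>\<^sub>E T" using yT y by (auto simp: PiE_def)
      ultimately show "y \<in> onto_colorings G T" using yT by (auto simp: onto_colorings_def)
    qed
    have "finite (pverts G \<rightarrow>\<^sub>E T)" using assms G.pair_finite_verts by (intro finite_PiE) auto
    then show "finite (onto_colorings G T)" by (simp add: onto_colorings_def)
  qed
qed

lemma card_onto_colorings_eq:
  assumes "pair_graph G" "finite S" "finite T" "card S = card T"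
  shows "card (onto_colorings G S) = card (onto_colorings G T)"
  using card_onto_colorings_le[OF assms] card_onto_colorings_le[OF assms(1,3,2)] assms(4) by simp

lemma onto_colorings_empty:
  assumes "finite (pverts G)" "card (pverts G) < card S"
  shows "onto_colorings G S = {}"
proof (rule equals0I)
  fix f assume "f \<in> onto_colorings G S"
  then have "f ` pverts G = S" by (simp add: onto_colorings_def)
  then show False using assms(2) card_image_le[OF assms(1), of f] by simp
qed

lemma card_proper_colorings:
  assumes "pair_graph G"
  shows "card (proper_colorings G k) =
    (\<Sum>j\<le>card (pverts G). (k choose j) * card (onto_colorings G {..<j}))"
proof -
  interpret G: pair_graph G by fact
  let ?n = "card (pverts G)"
  have un: "proper_colorings G k = (\<Union>S\<in>Pow {..<k}. onto_colorings G S)"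
  proof (intro equalityI subsetI)
    fix f assume f: "f \<in> proper_colorings G k"
    then have "f \<in> onto_colorings G (f ` pverts G)" "f ` pverts G \<in> Pow {..<k}"
      by (auto simp: proper_colorings_def onto_colorings_def PiE_def)
    then show "f \<in> (\<Union>S\<in>Pow {..<k}. onto_colorings G S)" by blast
  qed (auto simp: proper_colorings_def onto_colorings_def PiE_def Pi_def)
  have fin: "finite (onto_colorings G S)" if "finite S" for S
  proof -
    have "finite (pverts G \<rightarrow>\<^sub>E S)" using that G.pair_finite_verts by (intro finite_PiE) auto
    then show ?thesis by (simp add: onto_colorings_def)
  qed
  have "card (proper_colorings G k) = (\<Sum>S\<in>Pow {..<k}. card (onto_colorings G S))"
    unfolding un
  proof (rule card_UN_disjoint)
    show "\<forall>S\<in>Pow {..<k}. finite (onto_colorings G S)"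
      using fin finite_subset[of _ "{..<k}"] by blast
  qed (auto simp: onto_colorings_def)
  also have "\<dots> = (\<Sum>S\<in>Pow {..<k}. card (onto_colorings G {..<card S}))"
    by (intro sum.cong refl card_onto_colorings_eq[OF assms]) (auto intro: finite_subset)
  also have "\<dots> = (\<Sum>j\<le>k. \<Sum>S\<in>{S \<in> Pow {..<k}. card S = j}. card (onto_colorings G {..<card S}))"
    by (rule sum.group[symmetric])
       (auto simp: card_mono[of "{..<k}", simplified])
  also have "\<dots> = (\<Sum>j\<le>k. (k choose j) * card (onto_colorings G {..<j}))"
    using n_subsets[of "{..<k}"] by (intro sum.cong refl) simp
  also have "\<dots> = (\<Sum>j\<le>max k ?n. (k choose j) * card (onto_colorings G {..<j}))"
    by (rule sum.mono_neutral_left) auto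
  also have "\<dots> = (\<Sum>j\<le>?n. (k choose j) * card (onto_colorings G {..<j}))"
    by (rule sum.mono_neutral_right) (auto simp: onto_colorings_empty)
  finally show ?thesis .
qed

lemma degree_falling_poly: "degree (\<Prod>i<j. [:- of_nat i, 1::real:]) = j"
  by (subst degree_prod_eq_sum_degree) auto

lemma card_onto_colorings_all:
  assumes "pair_graph G"
  shows "card (onto_colorings G {..<card (pverts G)}) = fact (card (pverts G))"
proof -
  interpret G: pair_graph G by fact
  let ?n = "card (pverts G)" and ?V = "pverts G"
  have "f \<in> onto_colorings G {..<?n} \<longleftrightarrow> f \<in> ?V \<rightarrow>\<^sub>E {..<?n} \<and> inj_on f ?V" for f
  proof
    assume "f \<in> onto_colorings G {..<?n}"
    then have "f \<in> ?V \<rightarrow>\<^sub>E {..<?n}" "f ` ?V = {..<?n}" by (auto simp: onto_colorings_def)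
    then show "f \<in> ?V \<rightarrow>\<^sub>E {..<?n} \<and> inj_on f ?V"
      using G.pair_finite_verts by (simp add: inj_on_iff_eq_card)
  next
    assume f: "f \<in> ?V \<rightarrow>\<^sub>E {..<?n} \<and> inj_on f ?V"
    then have "f ` ?V = {..<?n}"
      by (intro card_subset_eq) (auto simp: card_image)
    moreover have "f u \<noteq> f v" if "(u, v) \<in> parcs G" for u v
    proof -
      have "u \<in> ?V" "v \<in> ?V" "u \<noteq> v" using G.wellformed'[OF that] G.pair_no_loops[OF that] by simp_all
      then show ?thesis using f by (meson inj_onD)
    qed
    ultimately show "f \<in> onto_colorings G {..<?n}" using f by (auto simp: onto_colorings_def)
  qed
  then have "onto_colorings G {..<?n} = {f \<in> ?V \<rightarrow>\<^sub>E {..<?n}. inj_on f ?V}" by blast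
  then show ?thesis
    using card_inj_on_subset_funcset[of ?V "{..<?n}" ?V] G.pair_finite_verts
    by (simp add: fact_prod_rev atLeast0LessThan)
qed

lemma chromatic_poly_aux:
  assumes "pair_graph G"
  shows "\<exists>p :: real poly. degree p = card (pverts G) \<and> lead_coeff p = 1 \<and>
           (\<forall>k. poly p (of_nat k) = of_nat (card (proper_colorings G k)))"
proof (intro exI conjI allI)
  let ?p = "\<Sum>j\<le>card (pverts G). smult (of_nat (card (onto_colorings G {..<j})) / fact j)
              (\<Prod>i<j. [:- of_nat i, 1::real:])"
  have le: "degree ?p \<le> card (pverts G)"
    by (intro degree_sum_le order.trans[OF degree_smult_le]) (auto simp: degree_falling_poly)
  have lead: "coeff (\<Prod>i<j. [:- of_nat i, 1::real:]) j = 1" for j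
    using lead_coeff_prod[of "\<lambda>i. [:- of_nat i, 1::real:]" "{..<j}"]
    by (simp add: degree_falling_poly)
  have "coeff ?p (card (pverts G)) = (\<Sum>j\<in>{card (pverts G)}. 1)"
    unfolding coeff_sum
    by (rule sum.mono_neutral_cong_right)
       (auto simp: lead card_onto_colorings_all[OF assms] degree_falling_poly coeff_eq_0)
  then have one: "coeff ?p (card (pverts G)) = 1" by simp
  show deg: "degree ?p = card (pverts G)"
    using le le_degree[of ?p "card (pverts G)"] one by simp
  show "lead_coeff ?p = 1" using one deg by simp
  show "poly ?p (of_nat k) = of_nat (card (proper_colorings G k))" for k
    unfolding card_proper_colorings[OF assms]
    by (auto simp: poly_sum poly_prod binomial_gbinomial gbinomial_prod_rev atLeast0LessThan
             intro!: sum.cong)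
qed

lemma poly_eq_of_nat:
  fixes p q :: "real poly"
  assumes "\<And>k::nat. poly p (of_nat k) = poly q (of_nat k)"
  shows "p = q"
proof (rule ccontr)
  assume "p \<noteq> q"
  then have "finite {x. poly (p - q) x = 0}" by (intro poly_roots_finite) simp
  moreover have "range (of_nat :: nat \<Rightarrow> real) \<subseteq> {x. poly (p - q) x = 0}" using assms by auto
  ultimately have "finite (range (of_nat :: nat \<Rightarrow> real))" by (rule rev_finite_subset)
  then show False by (simp add: finite_image_iff inj_on_def)
qed

lemma chromatic_poly_props:
  assumes "pair_graph G"
  shows poly_chromatic_poly:
      "poly (chromatic_poly G) (of_nat k) = of_nat (card (proper_colorings G k))"
    and degree_chromatic_poly: "degree (chromatic_poly G) = card (pverts G)"
    and lead_coeff_chromatic_poly: "lead_coeff (chromatic_poly G) = 1"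
proof -
  obtain p :: "real poly" where p: "degree p = card (pverts G)" "lead_coeff p = 1"
    "\<And>k. poly p (of_nat k) = of_nat (card (proper_colorings G k))"
    using chromatic_poly_aux[OF assms] by blast
  have "chromatic_poly G = p"
    unfolding chromatic_poly_def
    by (rule the_equality) (auto simp: p intro: poly_eq_of_nat)
  then show "poly (chromatic_poly G) (of_nat k) = of_nat (card (proper_colorings G k))"
    "degree (chromatic_poly G) = card (pverts G)" "lead_coeff (chromatic_poly G) = 1"
    using p by auto
qed

lemma degree_pochhammer_X: "degree (pochhammer [:0, 1::real:] i) = i"
  and lead_coeff_pochhammer_X: "coeff (pochhammer [:0, 1::real:] i) i = 1"
proof -
  have eq: "pochhammer [:0, 1::real:] i = (\<Prod>j<i. [:of_nat j, 1:])"
    by (auto simp: pochhammer_prod of_nat_poly atLeast0LessThan)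
  show deg: "degree (pochhammer [:0, 1::real:] i) = i"
    unfolding eq by (subst degree_prod_eq_sum_degree) auto
  have "lead_coeff (pochhammer [:0, 1::real:] i) = 1"
    unfolding eq by (simp add: lead_coeff_prod)
  then show "coeff (pochhammer [:0, 1::real:] i) i = 1" by (simp add: deg)
qed

lemma rising_expansion_ex1:
  fixes p :: "real poly"
  assumes "degree p \<le> n"
  shows "\<exists>!c. (\<forall>i>n. c i = 0) \<and>
           p = (\<Sum>i\<le>n. smult ((-1) ^ (n - i) * c i) (pochhammer [:0, 1:] i))"
proof -
  have ex: "\<exists>d. q = (\<Sum>i\<le>m. smult (d i) (pochhammer [:0, 1:] i))"
    if "degree q \<le> m" for q :: "real poly" and m
    using that
  proof (induction m arbitrary: q)
    case 0
    then show ?case by (auto elim!: degree_eq_zeroE intro!: exI[of _ "\<lambda>_. coeff q 0"])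
  next
    case (Suc m)
    let ?a = "coeff q (Suc m)"
    let ?r = "q - smult ?a (pochhammer [:0, 1:] (Suc m))"
    have "degree ?r \<le> m"
    proof (rule degree_le, intro allI impI)
      fix i assume "m < i"
      then consider "i = Suc m" | "i > Suc m" by linarith
      then show "coeff ?r i = 0"
        using Suc.prems lead_coeff_pochhammer_X[of "Suc m"] degree_pochhammer_X[of "Suc m"]
        by cases (auto simp: coeff_eq_0 simp del: pochhammer_Suc)
    qed
    from Suc.IH[OF this] obtain d where
      d: "?r = (\<Sum>i\<le>m. smult (d i) (pochhammer [:0, 1:] i))" by blast
    have "q = ?r + smult ?a (pochhammer [:0, 1:] (Suc m))" by simp
    also have "\<dots> = (\<Sum>i\<le>Suc m. smult ((d(Suc m := ?a)) i) (pochhammer [:0, 1:] i))"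
      unfolding d by simp
    finally show ?case by blast
  qed
  have indep: "\<forall>i\<le>m. d i = 0"
    if "(\<Sum>i\<le>m. smult (d i) (pochhammer [:0, 1::real:] i)) = 0" for d and m
    using that
  proof (induction m)
    case (Suc m)
    let ?s = "\<Sum>i\<le>m. smult (d i) (pochhammer [:0, 1::real:] i)"
    have "degree ?s \<le> m"
      by (intro degree_sum_le order.trans[OF degree_smult_le]) (auto simp: degree_pochhammer_X)
    then have "coeff ?s (Suc m) = 0" by (intro coeff_eq_0) simp
    moreover have "coeff (?s + smult (d (Suc m)) (pochhammer [:0, 1:] (Suc m))) (Suc m) = 0"
      using Suc.prems by simp
    ultimately have "d (Suc m) = 0" using lead_coeff_pochhammer_X[of "Suc m"] by simp
    then show ?case using Suc by (auto simp: le_Suc_eq)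
  qed auto
  obtain d where d: "p = (\<Sum>i\<le>n. smult (d i) (pochhammer [:0, 1:] i))" using ex assms by blast
  let ?c = "\<lambda>i. if i \<le> n then (-1) ^ (n - i) * d i else 0"
  show ?thesis
  proof (rule ex1I[of _ ?c])
    show "(\<forall>i>n. ?c i = 0) \<and>
        p = (\<Sum>i\<le>n. smult ((-1) ^ (n - i) * ?c i) (pochhammer [:0, 1:] i))"
      unfolding d by (auto intro!: sum.cong simp flip: mult.assoc power_mult_distrib)
  next
    fix c assume c: "(\<forall>i>n. c i = 0) \<and>
        p = (\<Sum>i\<le>n. smult ((-1) ^ (n - i) * c i) (pochhammer [:0, 1:] i))"
    then have "(\<Sum>i\<le>n. smult ((-1) ^ (n - i) * c i - d i) (pochhammer [:0, 1::real:] i)) = 0"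
      using d by (simp add: smult_diff_left sum_subtractf)
    from indep[OF this] have "\<forall>i\<le>n. (-1) ^ (n - i) * c i = d i" by simp
    then have e: "d i = (-1) ^ (n - i) * c i" if "i \<le> n" for i using that by simp
    have "c i = ?c i" for i
      using c by (auto simp: e simp flip: mult.assoc power_mult_distrib)
    then show "c = ?c" by blast
  qed
qed

lemma tau_coeff_props:
  assumes "pair_graph G"
  shows "i > card (pverts G) \<Longrightarrow> tau_coeff G i = 0"
    and "chromatic_poly G =
          (\<Sum>i\<le>card (pverts G).
             smult ((-1) ^ (card (pverts G) - i) * tau_coeff G i) (pochhammer [:0, 1:] i))"
  using theI'[OF rising_expansion_ex1[OF eq_refl[OF degree_chromatic_poly[OF assms]]]]
  unfolding tau_coeff_def[symmetric] by blast+

end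

theory Submission
  imports Defs
begin

text \<open>
  Let \<open>D = 1 + d/dx\<close> act on polynomials in \<open>x\<close>, and let \<open>Z p = x D (D p)\<close>. The linear map
  \<open>umbral\<close>, which sends \<open>x^i\<close> to \<open>(-1)^i x (x + 1) \<dots> (x + i - 1)\<close>, takes \<open>\<tau>\<^sub>G\<close> to \<open>\<plusminus> \<chi>\<^sub>G\<close> and turns
  \<open>Z\<close> into \<open>p(x) \<mapsto> - x p(x - 1)\<close>, which up to sign is what joining one more vertex does to a
  chromatic polynomial. Colouring \<open>G \<or> H\<close> by first choosing the set of colours used on \<open>G\<close> then shows
  that \<open>\<tau>\<close> of the join arises from \<open>\<tau>\<^sub>H\<close> by the same polynomial in \<open>Z\<close> that produces \<open>\<tau>\<^sub>G\<close> from
  \<open>1\<close> (\<open>tau_poly_eq_sum_join_vertex\<close>, \<open>tau_poly_graph_join\<close>).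

  Real zeros of \<open>\<tau>\<^sub>G\<close> say little about the zeros of that polynomial in \<open>Z\<close>, so the linear factors of
  \<open>\<tau>\<^sub>G\<close> and \<open>\<tau>\<^sub>H\<close> themselves have to be used.
  If both graphs have a vertex, then \<open>\<tau>\<^sub>G = x p\<close> and \<open>\<tau>\<^sub>H = x q\<close>, because no colouring uses zero
  colours. The heart of the argument is the identity \<open>\<tau>\<^bsub>G \<or> H\<^esub> = x D (M(p, q))\<close>
  (\<open>tau_poly_join_laguerre_pairing\<close>), where the bilinear form \<open>M\<close> is given on powers by
  \<open>M(x^i, x^j) = L\<^bsub>i+1,j+1\<^esub> L\<^bsub>j,i\<^esub>\<close> with the Laguerre polynomials \<open>L\<^bsub>a,b\<^esub> = D^b x^a\<close>. It
  holds because \<open>M(D (D (x p)), q) = D (x D (M(p, q)))\<close>, which on powers is a contiguity relation for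
  products of two Laguerre polynomials.

  In this form the zeros are under control by an argument of Heilmann--Lieb type. Expanding the Laguerre
  polynomials shows that \<open>M(p, q)(w)\<close> is the value at \<open>x = w\<close>, \<open>y = 1\<close> of
  \<open>(1 + \<partial>\<^sub>x) q((1 + \<partial>\<^sub>x)(w + \<partial>\<^sub>y))\<close> applied to \<open>x p(x y)\<close>. The coefficients of \<open>\<tau>\<close> are nonnegative
  (deletion and contraction), so \<open>p\<close> and \<open>q\<close> have all their zeros in \<open>(-\<infinity>, 0]\<close>. Let \<open>w\<close> lie
  outside \<open>(-\<infinity>, 0]\<close> and let \<open>\<zeta>\<close> be its square root with positive real part. If \<open>x/\<zeta>\<close> and \<open>\<zeta>y\<close> lie
  in the right half-plane, then \<open>x y\<close> is not in \<open>(-\<infinity>, 0]\<close> and hence \<open>x p(x y) \<noteq> 0\<close>. Being free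
  of zeros on this product of half-planes is preserved by each factor \<open>(1 + \<partial>\<^sub>x)(w + \<partial>\<^sub>y) + b\<close> with
  \<open>b \<ge> 0\<close> (\<open>bivariate_step\<close>), since the logarithmic derivative of a polynomial without zeros in a
  half-plane takes its values in a half-plane. So \<open>M(p, q)(w) \<noteq> 0\<close>, and for the same reason
  \<open>D (M(p, q))(w) \<noteq> 0\<close>.
\<close>

section \<open>Linear operators on polynomials\<close>

definition poly_linear :: "('a::comm_ring_1 poly \<Rightarrow> 'a poly) \<Rightarrow> bool" where
  "poly_linear S \<longleftrightarrow> (\<forall>p q. S (p + q) = S p + S q) \<and> (\<forall>c p. S (smult c p) = smult c (S p))"

lemma poly_linear_add: "poly_linear S \<Longrightarrow> S (p + q) = S p + S q"
  and poly_linear_smult: "poly_linear S \<Longrightarrow> S (smult c p) = smult c (S p)"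
  by (auto simp: poly_linear_def)

lemma poly_linear_0: "poly_linear S \<Longrightarrow> S 0 = 0"
  using poly_linear_smult[of S 0 0] by simp

lemma poly_linear_sum: "poly_linear S \<Longrightarrow> S (\<Sum>i\<in>I. f i) = (\<Sum>i\<in>I. S (f i))"
  by (induction I rule: infinite_finite_induct) (auto simp: poly_linear_0 poly_linear_add)

lemma poly_linear_id: "poly_linear (\<lambda>p. p)"
  and poly_linear_comp: "poly_linear S \<Longrightarrow> poly_linear T \<Longrightarrow> poly_linear (\<lambda>p. S (T p))"
  and poly_linear_mult: "poly_linear S \<Longrightarrow> poly_linear (\<lambda>p. r * S p)"
  by (auto simp: poly_linear_def algebra_simps smult_add_right)

lemma poly_linear_funpow: "poly_linear S \<Longrightarrow> poly_linear (S ^^ n)"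
  by (induction n) (auto simp: poly_linear_def)

lemma poly_linear_eqI:
  assumes "poly_linear S" "poly_linear T" "\<And>i. S (monom 1 i) = T (monom 1 i)"
  shows "S p = T p"
proof -
  have "U p = (\<Sum>i\<le>degree p. smult (coeff p i) (U (monom 1 i)))" if U: "poly_linear U" for U
  proof -
    have "U p = U (\<Sum>i\<le>degree p. smult (coeff p i) (monom 1 i))"
      by (simp add: smult_monom poly_as_sum_of_monoms)
    then show ?thesis by (simp add: poly_linear_sum[OF U] poly_linear_smult[OF U])
  qed
  from this[OF assms(1)] this[OF assms(2)] show ?thesis using assms(3) by simp
qed

definition linear_extension :: "(nat \<Rightarrow> 'a::comm_ring_1 poly) \<Rightarrow> 'a poly \<Rightarrow> 'a poly" where
  "linear_extension \<phi> p = (\<Sum>i\<le>degree p. smult (coeff p i) (\<phi> i))"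

lemma linear_extension_eq_sum:
  assumes "degree p \<le> n"
  shows "linear_extension \<phi> p = (\<Sum>i\<le>n. smult (coeff p i) (\<phi> i))"
  unfolding linear_extension_def
  by (rule sum.mono_neutral_left) (use assms in \<open>auto simp: coeff_eq_0\<close>)

lemma smult_sum_right: "smult c (\<Sum>i\<in>I. f i) = (\<Sum>i\<in>I. smult c (f i))"
  by (induction I rule: infinite_finite_induct) (auto simp: smult_add_right)

lemma poly_linear_linear_extension: "poly_linear (linear_extension \<phi>)"
  unfolding poly_linear_def
proof (intro conjI allI)
  fix p q :: "'a poly" and c :: 'a
  let ?n = "max (degree p) (degree q)"
  show "linear_extension \<phi> (p + q) = linear_extension \<phi> p + linear_extension \<phi> q"
    using linear_extension_eq_sum[of p ?n \<phi>] linear_extension_eq_sum[of q ?n \<phi>]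
      linear_extension_eq_sum[of "p + q" ?n \<phi>]
    by (simp add: degree_add_le smult_add_left sum.distrib)
  show "linear_extension \<phi> (smult c p) = smult c (linear_extension \<phi> p)"
    using linear_extension_eq_sum[of "smult c p" "degree p" \<phi>] degree_smult_le[of c p]
    by (simp add: linear_extension_def smult_sum_right)
qed

lemma linear_extension_monom: "linear_extension \<phi> (monom 1 i) = \<phi> i"
proof -
  have "linear_extension \<phi> (monom 1 i) = (\<Sum>j\<le>i. smult (coeff (monom 1 i) j) (\<phi> j))"
    by (rule linear_extension_eq_sum) (simp add: degree_monom_le)
  also have "\<dots> = (\<Sum>j\<in>{i}. \<phi> j)"
    by (rule sum.mono_neutral_cong_right) (auto simp: coeff_monom)
  finally show ?thesis by simp
qed

section \<open>Laguerre polynomials\<close>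

definition deriv_plus :: "'a::field_char_0 \<Rightarrow> 'a poly \<Rightarrow> 'a poly" where
  "deriv_plus c p = smult c p + pderiv p"

lemma poly_linear_deriv_plus: "poly_linear (deriv_plus c)"
  by (auto simp: poly_linear_def deriv_plus_def pderiv_add pderiv_smult algebra_simps smult_add_right)

text \<open>
  This is \<open>\<Sum>k. (a choose k) (b choose k) k! x^(a - k)\<close>; up to powers of \<open>x\<close> it counts the
  matchings of the complete bipartite graph with sides of \<open>a\<close> and \<open>b\<close> vertices by their size.
\<close>

definition laguerre :: "nat \<Rightarrow> nat \<Rightarrow> 'a::field_char_0 poly" where
  "laguerre a b = (deriv_plus 1 ^^ b) (monom 1 a)"

lemma laguerre_0: "laguerre a 0 = monom 1 a"
  and laguerre_Suc: "laguerre a (Suc b) = laguerre a b + pderiv (laguerre a b)"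
  by (simp_all add: laguerre_def deriv_plus_def)

lemma laguerre_one_left: "laguerre (Suc 0) b = [:of_nat b, 1:]"
  by (induction b) (simp_all add: laguerre_0 laguerre_Suc monom_Suc monom_0 pderiv_pCons)

lemma pderiv_X_mult: "pderiv ([:0, 1:] * p) = p + [:0, 1:] * pderiv (p :: 'a::field_char_0 poly)"
  unfolding pderiv_mult by (simp add: pderiv_pCons)

lemma pderiv_of_nat_mult: "pderiv (of_nat n * p) = of_nat n * pderiv (p :: 'a::field_char_0 poly)"
  by (simp add: pderiv_mult pderiv_of_nat)

lemma laguerre_Suc_left:
  "laguerre (Suc a) (Suc b) = [:0, 1:] * laguerre a (Suc b) + of_nat (Suc b) * laguerre a b"
proof (induction b)
  case 0
  then show ?case
    by (simp add: laguerre_0 laguerre_Suc monom_Suc pderiv_pCons)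
next
  case (Suc b)
  have "laguerre (Suc a) (Suc (Suc b)) =
      laguerre (Suc a) (Suc b) + pderiv (laguerre (Suc a) (Suc b) :: 'a poly)"
    by (rule laguerre_Suc)
  also have "\<dots> = [:0, 1:] * (laguerre a (Suc b) + pderiv (laguerre a (Suc b)))
      + of_nat (Suc b) * (laguerre a b + pderiv (laguerre a b)) + laguerre a (Suc b)"
    unfolding Suc.IH pderiv_add pderiv_of_nat_mult pderiv_X_mult
    by (simp add: algebra_simps del: mult_pCons_left mult_pCons_right)
  also have "\<dots> = [:0, 1:] * laguerre a (Suc (Suc b)) + of_nat (Suc (Suc b)) * laguerre a (Suc b)"
    unfolding laguerre_Suc[symmetric] by (simp add: algebra_simps)
  finally show ?case .
qed

lemma X_pderiv_monom: "[:0, 1:] * pderiv (monom 1 a) = of_nat a * (monom 1 a :: 'a::field_char_0 poly)"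
  by (cases a) (simp_all add: pderiv_monom monom_Suc[symmetric] of_nat_poly smult_monom)

lemma pderiv_laguerre: "pderiv (laguerre (Suc a) b) = of_nat (Suc a) * (laguerre a b :: 'a::field_char_0 poly)"
proof (induction b)
  case 0
  then show ?case by (simp add: laguerre_0 pderiv_monom of_nat_poly smult_monom)
next
  case (Suc b)
  then show ?case
    by (simp add: laguerre_Suc pderiv_add pderiv_of_nat_mult distrib_left del: of_nat_Suc)
qed

text \<open>
  The equation \<open>x f' = a f\<close> of \<open>f = x^a\<close>, transported through \<open>D^(b + 1)\<close>; moving \<open>x\<close> across the
  power of \<open>D\<close> leaves \<open>b + 1\<close> copies of \<open>D^b\<close>. Since \<open>laguerre a (b + 1) = F + F'\<close> with
  \<open>F = laguerre a b\<close>, this is also Laguerre's second-order equation for \<open>F\<close>, \<open>X_pderiv2_laguerre\<close>.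
\<close>

lemma X_pderiv_laguerre:
  "[:0, 1:] * pderiv (laguerre a (Suc b)) =
     of_nat a * laguerre a (Suc b) - of_nat (Suc b) * pderiv (laguerre a b :: 'a::field_char_0 poly)"
proof (induction b)
  case 0
  let ?F = "laguerre a 0 :: 'a poly"
  have F: "[:0, 1:] * pderiv ?F = of_nat a * ?F" by (simp only: laguerre_0 X_pderiv_monom)
  have "pderiv ([:0, 1:] * pderiv ?F) = of_nat a * pderiv ?F"
    unfolding F by (simp add: pderiv_of_nat_mult)
  then have "[:0, 1:] * pderiv (pderiv ?F) = of_nat a * pderiv ?F - pderiv ?F"
    unfolding pderiv_X_mult by (simp add: algebra_simps del: mult_pCons_left mult_pCons_right)
  with F show ?case
    by (simp add: laguerre_Suc pderiv_add algebra_simps del: mult_pCons_left mult_pCons_right)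
next
  case (Suc b)
  let ?F = "laguerre a (Suc b) :: 'a poly" and ?G = "laguerre a b :: 'a poly"
  have FG: "?F = ?G + pderiv ?G" by (rule laguerre_Suc)
  have "pderiv ([:0, 1:] * pderiv ?F) = of_nat a * pderiv ?F - of_nat (Suc b) * pderiv (pderiv ?G)"
    unfolding Suc.IH by (simp add: pderiv_of_nat_mult pderiv_diff del: of_nat_Suc)
  then have "[:0, 1:] * pderiv (pderiv ?F)
      = of_nat a * pderiv ?F - of_nat (Suc b) * pderiv (pderiv ?G) - pderiv ?F"
    unfolding pderiv_X_mult by (simp add: algebra_simps del: mult_pCons_left mult_pCons_right of_nat_Suc)
  moreover have "pderiv (pderiv ?G) = pderiv ?F - pderiv ?G"
    by (simp add: FG pderiv_add)
  moreover have "laguerre a (Suc (Suc b)) = ?F + pderiv ?F" by (rule laguerre_Suc)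
  ultimately show ?case using Suc.IH
    by (simp add: pderiv_add algebra_simps del: mult_pCons_left mult_pCons_right)
qed

lemma X_pderiv2_laguerre:
  fixes a b :: nat
  defines "F \<equiv> laguerre a b :: 'a::field_char_0 poly"
  shows "[:0, 1:] * pderiv (pderiv F) =
     of_nat a * (F + pderiv F) - of_nat (Suc b) * pderiv F - [:0, 1:] * pderiv F"
  using X_pderiv_laguerre[of a b, where 'a = 'a]
  unfolding F_def laguerre_Suc pderiv_add
  by (simp add: algebra_simps del: mult_pCons_left mult_pCons_right)

text \<open>
  Write \<open>A = laguerre (i + 1) (j + 1)\<close> and \<open>B = laguerre j i\<close>. All neighbouring Laguerre polynomials on
  the left-hand side are combinations of \<open>A\<close>, \<open>A'\<close> and of \<open>B\<close>, \<open>B'\<close>, and Laguerre's equation removes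
  \<open>A''\<close> and \<open>B''\<close> from the right-hand side. What remains is an identity between the four products
  \<open>A B\<close>, \<open>A' B\<close>, \<open>A B'\<close>, \<open>A' B'\<close>.
\<close>

lemma laguerre_product_recurrence:
  defines "D \<equiv> deriv_plus (1::'a::field_char_0)"
  shows "laguerre (Suc (Suc i)) (Suc j) * laguerre j (Suc i)
     + of_nat (2 * Suc i) * (laguerre (Suc i) (Suc j) * laguerre j i)
     + of_nat (i * Suc i) * (laguerre i (Suc j) * laguerre j (i - 1))
     = D ([:0, 1:] * D (laguerre (Suc i) (Suc j) * laguerre j i))"
proof -
  let ?X = "[:0, 1:] :: 'a poly"
  define A B C E F :: "'a poly" where "A = laguerre (Suc i) (Suc j)" and "B = laguerre j i"
    and "C = laguerre i (Suc j)" and "E = laguerre (Suc i) j" and "F = laguerre j (i - 1)"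
  have D: "D p = p + pderiv p" for p by (simp add: D_def deriv_plus_def)
  have 1: "laguerre (Suc (Suc i)) (Suc j) = ?X * A + of_nat (Suc j) * E"
    unfolding A_def E_def by (rule laguerre_Suc_left)
  have 2: "laguerre j (Suc i) = B + pderiv B" unfolding B_def by (rule laguerre_Suc)
  have 3: "of_nat (Suc i) * C = pderiv A"
    unfolding A_def C_def pderiv_laguerre ..
  have 4: "of_nat (Suc j) * E = ?X * pderiv A + of_nat (Suc j) * A - of_nat (Suc i) * A"
  proof -
    have "A = E + pderiv E" unfolding A_def E_def by (rule laguerre_Suc)
    then have "pderiv E = A - E" by simp
    then show ?thesis using X_pderiv_laguerre[of "Suc i" j, where 'a = 'a]
      unfolding A_def[symmetric] E_def[symmetric] unfolding \<open>pderiv E = A - E\<close> by (simp add: algebra_simps del: mult_pCons_left mult_pCons_right)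
  qed
  \<comment> \<open>For \<open>i = 0\<close> both sides vanish, because \<open>B\<close> is the power \<open>x^j\<close>.\<close>
  have 5: "of_nat i * F = ?X * pderiv B + of_nat i * B - of_nat j * B"
  proof (cases i)
    case 0
    then show ?thesis using X_pderiv_monom[of j, where 'a = 'a] 
      by (simp add: B_def laguerre_0 del: mult_pCons_left mult_pCons_right)
  next
    case (Suc k)
    have "B = F + pderiv F" unfolding B_def F_def Suc by (simp add: laguerre_Suc)
    then have "pderiv F = B - F" by simp
    then show ?thesis using X_pderiv_laguerre[of j k, where 'a = 'a]
      unfolding B_def[unfolded Suc, symmetric] F_def[unfolded Suc, simplified, symmetric]
      unfolding \<open>pderiv F = B - F\<close> unfolding Suc by (simp add: algebra_simps del: mult_pCons_left mult_pCons_right)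
  qed
  have A2: "?X * pderiv (pderiv A) =
      of_nat (Suc i) * (A + pderiv A) - of_nat (Suc (Suc j)) * pderiv A - ?X * pderiv A"
    unfolding A_def by (rule X_pderiv2_laguerre)
  have B2: "?X * pderiv (pderiv B) =
      of_nat j * (B + pderiv B) - of_nat (Suc i) * pderiv B - ?X * pderiv B"
    unfolding B_def by (rule X_pderiv2_laguerre)
  have pX: "pderiv ?X = 1" by (simp add: pderiv_pCons one_pCons)
  have CF: "of_nat (i * Suc i) * (C * F) = pderiv A * (?X * pderiv B + of_nat i * B - of_nat j * B)"
  proof -
    have "of_nat (i * Suc i) * (C * F) = (of_nat (Suc i) * C) * (of_nat i * F)"
      by (simp add: algebra_simps)
    then show ?thesis unfolding 3 5 .
  qed
  have DD: "D (?X * D (A * B)) = ?X * (A * B) + ?X * (pderiv A * B + A * pderiv B)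
     + ?X * (pderiv A * B + A * pderiv B) + A * B + pderiv A * B + A * pderiv B
     + (?X * pderiv (pderiv A)) * B + ?X * (pderiv A * pderiv B) + ?X * (pderiv A * pderiv B)
     + A * (?X * pderiv (pderiv B))"
    unfolding D pderiv_mult pderiv_add pX
    by (simp add: algebra_simps del: mult_pCons_left mult_pCons_right)
  show ?thesis
    unfolding A_def[symmetric] B_def[symmetric] C_def[symmetric] F_def[symmetric] 1 2 CF DD 4 A2 B2
    by (simp add: algebra_simps del: mult_pCons_left mult_pCons_right)
qed

section \<open>Joining with a vertex, and the bilinear form of a join\<close>

text \<open>
  The effect on \<open>\<tau>\<close> of joining a graph with one new vertex.
\<close>

definition join_vertex :: "'a::field_char_0 poly \<Rightarrow> 'a poly" where
  "join_vertex p = [:0, 1:] * deriv_plus 1 (deriv_plus 1 p)"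

text \<open>
  The exponents are shifted by one in the first factor only. This is the form in which the operator
  \<open>x D\<close> splits off from the \<open>\<tau>\<close>-polynomial of a join, and in which the pairing is the value of a
  differential operator on \<open>x p(x y)\<close>.
\<close>

definition laguerre_pairing :: "'a::field_char_0 poly \<Rightarrow> 'a poly \<Rightarrow> 'a poly" where
  "laguerre_pairing p q =
     linear_extension (\<lambda>i. linear_extension (\<lambda>j. laguerre (Suc i) (Suc j) * laguerre j i) q) p"

lemma poly_linear_laguerre_pairing_left: "poly_linear (\<lambda>p. laguerre_pairing p q)"
  unfolding laguerre_pairing_def by (rule poly_linear_linear_extension)

lemma laguerre_pairing_monom_left:
  "laguerre_pairing (monom 1 i) q = linear_extension (\<lambda>j. laguerre (Suc i) (Suc j) * laguerre j i) q"
  unfolding laguerre_pairing_def by (rule linear_extension_monom)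

lemma laguerre_pairing_one_left: "laguerre_pairing 1 q = deriv_plus 1 ([:0, 1:] * q)"
proof -
  have "linear_extension (\<lambda>j. laguerre (Suc 0) (Suc j) * laguerre j 0) q = deriv_plus 1 ([:0, 1:] * q)"
  proof (rule poly_linear_eqI[where p = q])
    show "poly_linear (\<lambda>q. deriv_plus (1::'a) ([:0, 1:] * q))"
      by (intro poly_linear_comp[OF poly_linear_deriv_plus] poly_linear_mult poly_linear_id)
    show "linear_extension (\<lambda>j. laguerre (Suc 0) (Suc j) * laguerre j 0) (monom 1 j)
            = deriv_plus (1::'a) ([:0, 1:] * monom 1 j)" for j
      unfolding linear_extension_monom deriv_plus_def pderiv_X_mult X_pderiv_monom
        laguerre_one_left laguerre_0
      by (simp add: of_nat_poly smult_add_left add.commute)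
  qed (rule poly_linear_linear_extension)
  then show ?thesis using laguerre_pairing_monom_left[of 0 q] by simp
qed

lemma deriv_plus_twice_X_mult_monom:
  "deriv_plus 1 (deriv_plus 1 ([:0, 1:] * monom 1 i)) =
     monom 1 (Suc i) + smult (of_nat (2 * Suc i)) (monom 1 i)
       + smult (of_nat (i * Suc i)) (monom (1::'a::field_char_0) (i - 1))"
proof (cases i)
  case 0
  then show ?thesis by (simp add: deriv_plus_def monom_Suc monom_0 pderiv_pCons)
next
  case (Suc k)
  then show ?thesis
    by (simp add: deriv_plus_def monom_Suc[symmetric] pderiv_add pderiv_monom smult_monom add_monom
        mult_2 algebra_simps)
qed

text \<open>
  Both sides are bilinear, so \<open>p\<close> and \<open>q\<close> may be taken to be powers of \<open>x\<close>; there the claim is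
  \<open>laguerre_product_recurrence\<close>.
\<close>

lemma laguerre_pairing_step:
  "laguerre_pairing (deriv_plus 1 (deriv_plus 1 ([:0, 1:] * p))) q
     = deriv_plus 1 ([:0, 1:] * deriv_plus 1 (laguerre_pairing p q))"
proof (rule poly_linear_eqI[where p = p])
  let ?D = "deriv_plus (1::'a)"
  show "poly_linear (\<lambda>p. laguerre_pairing (?D (?D ([:0, 1:] * p))) q)"
    by (intro poly_linear_comp[OF poly_linear_laguerre_pairing_left]
        poly_linear_comp[OF poly_linear_deriv_plus] poly_linear_mult poly_linear_id)
  show "poly_linear (\<lambda>p. ?D ([:0, 1:] * ?D (laguerre_pairing p q)))"
    by (intro poly_linear_comp[OF poly_linear_deriv_plus] poly_linear_mult
        poly_linear_laguerre_pairing_left)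
  let ?\<phi> = "\<lambda>i j. laguerre (Suc i) (Suc j) * laguerre j i :: 'a poly"
  fix i
  have "laguerre_pairing (?D (?D ([:0, 1:] * monom 1 i))) q
      = linear_extension (?\<phi> (Suc i)) q + smult (of_nat (2 * Suc i)) (linear_extension (?\<phi> i) q)
        + smult (of_nat (i * Suc i)) (linear_extension (?\<phi> (i - 1)) q)"
    unfolding deriv_plus_twice_X_mult_monom poly_linear_add[OF poly_linear_laguerre_pairing_left]
      poly_linear_smult[OF poly_linear_laguerre_pairing_left] laguerre_pairing_monom_left ..
  also have "\<dots> = ?D ([:0, 1:] * ?D (linear_extension (?\<phi> i) q))"
  proof (rule poly_linear_eqI[where p = q])
    show "poly_linear (\<lambda>q. linear_extension (?\<phi> (Suc i)) q
        + smult (of_nat (2 * Suc i)) (linear_extension (?\<phi> i) q)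
        + smult (of_nat (i * Suc i)) (linear_extension (?\<phi> (i - 1)) q))"
      using poly_linear_linear_extension[of "?\<phi> (Suc i)"] poly_linear_linear_extension[of "?\<phi> i"]
        poly_linear_linear_extension[of "?\<phi> (i - 1)"]
      unfolding poly_linear_def by (simp add: smult_add_right mult.commute)
    show "poly_linear (\<lambda>q. ?D ([:0, 1:] * ?D (linear_extension (?\<phi> i) q)))"
      by (intro poly_linear_comp[OF poly_linear_deriv_plus] poly_linear_mult
          poly_linear_linear_extension)
    fix j
    show "linear_extension (?\<phi> (Suc i)) (monom 1 j)
        + smult (of_nat (2 * Suc i)) (linear_extension (?\<phi> i) (monom 1 j))
        + smult (of_nat (i * Suc i)) (linear_extension (?\<phi> (i - 1)) (monom 1 j))
        = ?D ([:0, 1:] * ?D (linear_extension (?\<phi> i) (monom 1 j)))"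
      unfolding linear_extension_monom laguerre_product_recurrence[symmetric]
      by (cases i) (simp_all add: of_nat_poly del: of_nat_Suc of_nat_mult of_nat_add)
  qed
  finally show "laguerre_pairing (?D (?D ([:0, 1:] * monom 1 i))) q
      = ?D ([:0, 1:] * ?D (laguerre_pairing (monom 1 i) q))"
    unfolding laguerre_pairing_monom_left .
qed

text \<open>
  If \<open>Z\<^sup>i 1 = x p\<close>, then one more step replaces \<open>p\<close> by \<open>D (D (x p))\<close>, and
  \<open>laguerre_pairing_step\<close> says that the pairing follows suit.
\<close>

lemma join_vertex_funpow:
  "\<exists>p. (join_vertex ^^ Suc i) 1 = [:0, 1:] * p \<and>
     (\<forall>q. (join_vertex ^^ Suc i) ([:0, 1:] * q)
            = [:0, 1:] * deriv_plus 1 (laguerre_pairing p (q :: 'a::field_char_0 poly)))"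
proof (induction i)
  case 0
  then show ?case
    by (intro exI[of _ 1]) (simp add: join_vertex_def laguerre_pairing_one_left deriv_plus_def pderiv_1)
next
  case (Suc i)
  let ?D = "deriv_plus (1::'a)"
  from Suc.IH obtain p where p: "(join_vertex ^^ Suc i) 1 = [:0, 1:] * p"
    "\<And>q. (join_vertex ^^ Suc i) ([:0, 1:] * q) = [:0, 1:] * ?D (laguerre_pairing p q)"
    by blast
  have step: "(join_vertex ^^ Suc (Suc i)) r = join_vertex ((join_vertex ^^ Suc i) r)" for r :: "'a poly"
    by simp
  show ?case
    unfolding step p
    by (intro exI[of _ "?D (?D ([:0, 1:] * p))"])
      (simp only: join_vertex_def laguerre_pairing_step simp_thms)
qed

lemma sum_join_vertex_funpow:
  fixes p q :: "'a::field_char_0 poly"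
  assumes p: "(\<Sum>i=1..n. smult (\<alpha> i) ((join_vertex ^^ i) 1)) = [:0, 1:] * p"
  shows "(\<Sum>i=1..n. smult (\<alpha> i) ((join_vertex ^^ i) ([:0, 1:] * q)))
           = [:0, 1:] * deriv_plus 1 (laguerre_pairing p q)"
proof -
  from join_vertex_funpow obtain P where
    P: "\<And>i. (join_vertex ^^ Suc i) 1 = [:0, 1:] * P i"
    "\<And>i q. (join_vertex ^^ Suc i) ([:0, 1:] * q)
        = [:0, 1:] * deriv_plus 1 (laguerre_pairing (P i) (q :: 'a poly))"
    by metis
  have P': "(join_vertex ^^ i) 1 = [:0, 1:] * P (i - 1)"
    "(join_vertex ^^ i) ([:0, 1:] * q) = [:0, 1:] * deriv_plus 1 (laguerre_pairing (P (i - 1)) q)"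
    if "i \<in> {1..n}" for i
  proof -
    have i: "Suc (i - 1) = i" using that by simp
    show "(join_vertex ^^ i) 1 = [:0, 1:] * P (i - 1)"
      "(join_vertex ^^ i) ([:0, 1:] * q) = [:0, 1:] * deriv_plus 1 (laguerre_pairing (P (i - 1)) q)"
      using P(1)[of "i - 1"] P(2)[of "i - 1" q] unfolding i by blast+
  qed
  let ?S = "\<lambda>p. [:0, 1:] * deriv_plus 1 (laguerre_pairing p q)"
  have S: "poly_linear ?S"
    by (intro poly_linear_mult poly_linear_comp[OF poly_linear_deriv_plus]
        poly_linear_laguerre_pairing_left)
  have "[:0, 1:] * p = [:0, 1:] * (\<Sum>i=1..n. smult (\<alpha> i) (P (i - 1)))"
    unfolding p[symmetric] sum_distrib_left by (intro sum.cong refl) (simp only: P' mult_smult_right)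
  then have "p = (\<Sum>i=1..n. smult (\<alpha> i) (P (i - 1)))" by simp
  then have "?S p = (\<Sum>i=1..n. smult (\<alpha> i) (?S (P (i - 1))))"
    by (simp only: poly_linear_sum[OF S] poly_linear_smult[OF S])
  then show ?thesis by (simp only: P' cong: sum.cong)
qed

section \<open>Polynomials without zeros in a half-plane\<close>

text \<open>
  The logarithmic derivative is the sum of \<open>1 / (x - \<rho>)\<close> over the zeros \<open>\<rho>\<close>, and each
  \<open>u x - u \<rho>\<close> has positive real part. The factor \<open>u\<close> rotates an arbitrary half-plane bounded by a
  line through the origin to the right half-plane.
\<close>

lemma Re_logarithmic_derivative_nonneg:
  fixes p :: "complex poly"
  assumes "\<And>z. Re (u * z) > 0 \<Longrightarrow> poly p z \<noteq> 0" and "Re (u * x) > 0"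
  shows "Re (poly (pderiv p) x / (u * poly p x)) \<ge> 0"
  using assms(1)
proof (induction "degree p" arbitrary: p)
  case 0
  then have "pderiv p = 0" by (simp add: pderiv_eq_0_iff)
  then show ?case by simp
next
  case (Suc n)
  then have "\<not> constant (poly p)" by (simp add: constant_degree)
  then obtain \<rho> where \<rho>: "poly p \<rho> = 0" using fundamental_theorem_of_algebra by blast
  then obtain q where q: "p = [:- \<rho>, 1:] * q" by (metis poly_eq_0_iff_dvd dvdE)
  have q0: "q \<noteq> 0" using Suc.hyps(2) q by auto
  then have deg: "degree p = Suc (degree q)" unfolding q by (subst degree_mult_eq) auto
  have nz: "poly q z \<noteq> 0" if "Re (u * z) > 0" for z
    using Suc.prems[OF that] unfolding q by auto
  have IH: "Re (poly (pderiv q) x / (u * poly q x)) \<ge> 0"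
    using Suc.hyps deg nz by simp
  have "Re (u * \<rho>) \<le> 0" using Suc.prems[of \<rho>] \<rho> by linarith
  then have "Re (u * x - u * \<rho>) > 0" using assms(2) by simp
  then have "Re (1 / (u * x - u * \<rho>)) \<ge> 0" by (simp add: Re_divide)
  moreover have "poly (pderiv p) x / (u * poly p x)
      = 1 / (u * x - u * \<rho>) + poly (pderiv q) x / (u * poly q x)"
  proof -
    have "u \<noteq> 0" using assms(2) by auto
    moreover have "x \<noteq> \<rho>" using Suc.prems[OF assms(2)] \<rho> by auto
    moreover have "poly q x \<noteq> 0" using nz[OF assms(2)] .
    moreover have "poly (pderiv p) x = poly q x + (x - \<rho>) * poly (pderiv q) x"
      unfolding q by (simp only: pderiv_mult poly_add poly_mult) (simp add: pderiv_pCons algebra_simps)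
    ultimately show ?thesis
      unfolding q by (simp add: divide_simps) (simp add: algebra_simps)
  qed
  ultimately show ?case using IH by simp
qed

lemma half_plane_deriv_plus:
  fixes p :: "complex poly"
  assumes "\<And>z. Re (u * z) > 0 \<Longrightarrow> poly p z \<noteq> 0" and "Re (u * x) > 0" and "Re (c / u) > 0"
  shows "Re (poly (deriv_plus c p) x / (u * poly p x)) > 0"
    and "poly (deriv_plus c p) x \<noteq> 0"
proof -
  have "u \<noteq> 0" "poly p x \<noteq> 0" using assms by auto
  then have "poly (deriv_plus c p) x / (u * poly p x)
      = c / u + poly (pderiv p) x / (u * poly p x)"
    by (simp add: deriv_plus_def field_simps)
  then show 1: "Re (poly (deriv_plus c p) x / (u * poly p x)) > 0"
    using Re_logarithmic_derivative_nonneg[OF assms(1,2)] assms(3) by simp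
  then show "poly (deriv_plus c p) x \<noteq> 0" by auto
qed

lemma Re_reciprocal_pos: "Re z > 0 \<Longrightarrow> Re (1 / z) > 0"
  by (auto simp: Re_divide zero_less_divide_iff intro!: add_pos_nonneg)

lemma poly_deriv_plus_sum:
  "poly (deriv_plus c (\<Sum>k\<in>K. smult (\<alpha> k) (C k))) x = (\<Sum>k\<in>K. \<alpha> k * poly (deriv_plus c (C k)) x)"
  by (simp add: poly_linear_sum[OF poly_linear_deriv_plus] poly_linear_smult[OF poly_linear_deriv_plus] poly_sum)

text \<open>
  Let \<open>P\<close> be the given bivariate polynomial, \<open>U = (\<zeta>\<^sup>2 + \<partial>\<^sub>y) P\<close> and \<open>V = (1 + \<partial>\<^sub>x) U\<close>. In
  \<open>\<zeta> (V + b P) / U\<close> the first term has positive real part by the univariate statement in \<open>x\<close>, and the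
  second one has nonnegative real part because \<open>U / (\<zeta> P)\<close> has positive real part by the univariate statement
  in \<open>y\<close>. Hence \<open>V + b P\<close> does not vanish. A bivariate polynomial is written as a sum of products, so
  that fixing one variable leaves a univariate polynomial in the other.
\<close>

lemma bivariate_step:
  fixes C D :: "'k \<Rightarrow> complex poly" and \<zeta> :: complex and b :: real
  assumes nz: "\<And>x y. Re (x / \<zeta>) > 0 \<Longrightarrow> Re (\<zeta> * y) > 0 \<Longrightarrow>
                 (\<Sum>k\<in>K. \<alpha> k * poly (C k) x * poly (D k) y) \<noteq> 0"
    and \<zeta>: "Re \<zeta> > 0" and b: "b \<ge> 0" and x: "Re (x / \<zeta>) > 0" and y: "Re (\<zeta> * y) > 0"
  shows "(\<Sum>k\<in>K. \<alpha> k * poly (deriv_plus 1 (C k)) x * poly (deriv_plus (\<zeta>^2) (D k)) y)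
           + of_real b * (\<Sum>k\<in>K. \<alpha> k * poly (C k) x * poly (D k) y) \<noteq> 0"
proof -
  define P where "P x y = (\<Sum>k\<in>K. \<alpha> k * poly (C k) x * poly (D k) y)" for x y
  define U where "U x y = (\<Sum>k\<in>K. \<alpha> k * poly (C k) x * poly (deriv_plus (\<zeta>^2) (D k)) y)" for x y
  define V where "V = (\<Sum>k\<in>K. \<alpha> k * poly (deriv_plus 1 (C k)) x * poly (deriv_plus (\<zeta>^2) (D k)) y)"
  have z0: "\<zeta> \<noteq> 0" using \<zeta> by auto
  have U: "Re (U x y / (\<zeta> * P x y)) > 0" if x: "Re (x / \<zeta>) > 0" and y: "Re (\<zeta> * y) > 0" for x y
  proof -
    let ?p = "\<Sum>k\<in>K. smult (\<alpha> k * poly (C k) x) (D k)"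
    have "Re (poly (deriv_plus (\<zeta>^2) ?p) y / (\<zeta> * poly ?p y)) > 0"
      by (rule half_plane_deriv_plus)
        (use nz[OF x] y \<zeta> z0 in \<open>auto simp: poly_sum power2_eq_square mult_ac\<close>)
    then show ?thesis unfolding poly_deriv_plus_sum by (simp add: P_def U_def poly_sum)
  qed
  have V: "Re (\<zeta> * V / U x y) > 0"
  proof -
    let ?p = "\<Sum>k\<in>K. smult (\<alpha> k * poly (deriv_plus (\<zeta>^2) (D k)) y) (C k)"
    have p: "poly ?p z = U z y" for z by (simp add: poly_sum U_def mult_ac)
    have "U z y \<noteq> 0" if "Re (z / \<zeta>) > 0" for z using U[OF that y] by auto
    then have "Re (poly (deriv_plus 1 ?p) x / (1 / \<zeta> * poly ?p x)) > 0"
      by (intro half_plane_deriv_plus) (use p x \<zeta> in auto)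
    moreover have "poly (deriv_plus 1 ?p) x = V"
      unfolding poly_deriv_plus_sum by (simp add: V_def mult_ac)
    ultimately show ?thesis by (simp add: p mult_ac)
  qed
  have nzU: "U x y \<noteq> 0" using U[OF x y] by auto
  have P0: "P x y \<noteq> 0" using nz[OF x y] by (simp add: P_def)
  have "Re (\<zeta> * P x y / U x y) > 0"
  proof -
    have "\<zeta> * P x y / U x y = 1 / (U x y / (\<zeta> * P x y))" by simp
    then show ?thesis using Re_reciprocal_pos[OF U[OF x y]] by simp
  qed
  then have "Re (\<zeta> * V / U x y + of_real b * (\<zeta> * P x y / U x y)) > 0"
  proof -
    have "Re (of_real b * (\<zeta> * P x y / U x y)) = b * Re (\<zeta> * P x y / U x y)"
      by (simp only: times_complex.sel) simp
    then show ?thesis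
      using V b \<open>Re (\<zeta> * P x y / U x y) > 0\<close> by (simp only: plus_complex.sel) (simp add: add_pos_nonneg)
  qed
  moreover have "\<zeta> * V / U x y + of_real b * (\<zeta> * P x y / U x y) = \<zeta> * (V + of_real b * P x y) / U x y"
    by (simp add: field_simps add_divide_distrib)
  ultimately have "Re (\<zeta> * (V + of_real b * P x y) / U x y) > 0" by (simp only:)
  then have "V + of_real b * P x y \<noteq> 0" by auto
  then show ?thesis by (simp add: V_def P_def)
qed

section \<open>Zeros of the Laguerre pairing\<close>

lemma Re_csqrt_pos:
  assumes "z \<notin> \<real>\<^sub>\<le>\<^sub>0"
  shows "Re (csqrt z) > 0"
proof (rule ccontr)
  assume "\<not> Re (csqrt z) > 0"
  then have "Re (csqrt z) = 0" using Re_csqrt[of z] by simp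
  then have "(csqrt z)\<^sup>2 = of_real (- (Im (csqrt z))\<^sup>2)"
    by (simp add: complex_eq_iff power2_eq_square)
  then have "z = of_real (- (Im (csqrt z))\<^sup>2)" unfolding power2_csqrt .
  then have "z \<in> \<real>\<^sub>\<le>\<^sub>0" using nonpos_Reals_of_real_iff zero_le_power2 by (metis neg_le_0_iff_le)
  with assms show False by simp
qed

lemma mult_notin_nonpos_Reals:
  assumes "Re a > 0" "Re b > 0"
  shows "a * b \<notin> \<real>\<^sub>\<le>\<^sub>0"
proof
  assume "a * b \<in> \<real>\<^sub>\<le>\<^sub>0"
  then obtain r where r: "a * b = of_real r" "r \<le> 0" by (auto elim: nonpos_Reals_cases)
  have "a \<noteq> 0" using assms by auto
  then have "b = of_real r * (1 / a)" using r by (simp add: field_simps)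
  then have "Re b = r * Re (1 / a)" by (simp only: times_complex.sel) simp
  moreover have "Re (1 / a) > 0" using assms by (intro Re_reciprocal_pos)
  ultimately show False using r(2) assms(2) by (simp add: mult_nonpos_nonneg leD)
qed

lemma deriv_plus_funpow_X_mult:
  "(deriv_plus c ^^ j) ([:0, 1:] * p) =
     [:0, 1:] * (deriv_plus c ^^ j) p + smult (of_nat j) ((deriv_plus (c::'a::field_char_0) ^^ (j - 1)) p)"
proof (induction j)
  case (Suc j)
  have "(deriv_plus c ^^ Suc j) ([:0, 1:] * p)
      = deriv_plus c ([:0, 1:] * (deriv_plus c ^^ j) p) + smult (of_nat j) (deriv_plus c ((deriv_plus c ^^ (j - 1)) p))"
    unfolding funpow.simps o_apply Suc.IH poly_linear_add[OF poly_linear_deriv_plus]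
      poly_linear_smult[OF poly_linear_deriv_plus] ..
  moreover have "deriv_plus c ([:0, 1:] * r) = [:0, 1:] * deriv_plus c r + r" for r :: "'a poly"
    unfolding deriv_plus_def pderiv_X_mult
    by (simp add: algebra_simps mult_smult_right del: mult_pCons_left mult_pCons_right)
  moreover have "smult (of_nat j) (deriv_plus c ((deriv_plus c ^^ (j - 1)) p))
      = smult (of_nat j) ((deriv_plus c ^^ j) p)"
    by (cases j) simp_all
  ultimately show ?case
    by (simp add: smult_add_left algebra_simps del: mult_pCons_left mult_pCons_right)
qed simp

text \<open>
  Both sides are \<open>\<Sum>k. (i choose k) (j choose k) k! c^(j - k) d^(i - k)\<close>, which is invariant under
  exchanging \<open>(i, d)\<close> and \<open>(j, c)\<close>. With \<open>d = 1\<close> this reads \<open>laguerre j i\<close> at the point \<open>c\<close> as a value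
  of an operator in an auxiliary variable \<open>y\<close> at \<open>y = 1\<close>.
\<close>

lemma poly_deriv_plus_funpow_monom_sym:
  "poly ((deriv_plus c ^^ j) (monom 1 i)) d = poly ((deriv_plus d ^^ i) (monom 1 j)) (c::'a::field_char_0)"
proof (induction i arbitrary: j)
  case 0
  have "(deriv_plus c ^^ j) 1 = [:c ^ j:]"
    by (induction j) (simp_all add: deriv_plus_def pderiv_pCons one_pCons)
  then show ?case by (simp add: poly_monom)
next
  case (Suc i)
  have "poly ((deriv_plus c ^^ j) (monom 1 (Suc i))) d
      = d * poly ((deriv_plus c ^^ j) (monom 1 i)) d
        + of_nat j * poly ((deriv_plus c ^^ (j - 1)) (monom 1 i)) d"
    using deriv_plus_funpow_X_mult[where c = c and j = j and p = "monom 1 i"] by (simp add: monom_Suc)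
  also have "\<dots> = d * poly ((deriv_plus d ^^ i) (monom 1 j)) c
        + of_nat j * poly ((deriv_plus d ^^ i) (monom 1 (j - 1))) c"
    unfolding Suc.IH ..
  also have "\<dots> = poly ((deriv_plus d ^^ i) (deriv_plus d (monom 1 j))) c"
  proof -
    have "deriv_plus d (monom 1 j) = smult d (monom 1 j) + smult (of_nat j) (monom 1 (j - 1))"
      by (simp add: deriv_plus_def pderiv_monom smult_monom)
    then show ?thesis
      by (simp add: poly_linear_add[OF poly_linear_funpow[OF poly_linear_deriv_plus]]
          poly_linear_smult[OF poly_linear_funpow[OF poly_linear_deriv_plus]])
  qed
  finally show ?case by (simp add: funpow_swap1)
qed

text \<open>
  The functional \<open>q \<mapsto> \<Sum>j. coeff q j * f j\<close> replaces \<open>x^j\<close> by \<open>f j\<close>; multiplying \<open>q\<close> by \<open>x\<close> shifts \<open>f\<close>.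
\<close>

lemma sum_coeff_linear_factor_mult:
  fixes q :: "'a::comm_ring_1 poly" and f :: "nat \<Rightarrow> 'a"
  shows "(\<Sum>j\<le>degree ([:b, 1:] * q). coeff ([:b, 1:] * q) j * f j)
     = (\<Sum>j\<le>degree q. coeff q j * (f (Suc j) + b * f j))"
proof -
  let ?n = "degree q"
  have ext: "(\<Sum>j\<le>degree r. coeff r j * f j) = (\<Sum>j\<le>m. coeff r j * f j)" if "degree r \<le> m" for r m
    by (rule sum.mono_neutral_left) (use that in \<open>auto simp: coeff_eq_0\<close>)
  have "degree ([:b, 1:] * q) \<le> Suc ?n"
    using degree_mult_le[of "[:b, 1:]" q] by simp
  then have "(\<Sum>j\<le>degree ([:b, 1:] * q). coeff ([:b, 1:] * q) j * f j)
      = (\<Sum>j\<le>Suc ?n. coeff (pCons 0 q) j * f j) + b * (\<Sum>j\<le>Suc ?n. coeff q j * f j)"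
    by (subst ext) (auto simp: sum_distrib_left algebra_simps simp flip: sum.distrib)
  also have "(\<Sum>j\<le>Suc ?n. coeff (pCons 0 q) j * f j) = (\<Sum>j\<le>?n. coeff q j * f (Suc j))"
    by (subst sum.atMost_Suc_shift) simp
  also have "(\<Sum>j\<le>Suc ?n. coeff q j * f j) = (\<Sum>j\<le>?n. coeff q j * f j)"
    by (rule ext[symmetric]) simp
  finally show ?thesis by (simp add: sum_distrib_left algebra_simps sum.distrib)
qed

text \<open>
  The sum is \<open>q((1 + \<partial>\<^sub>x)(\<zeta>\<^sup>2 + \<partial>\<^sub>y))\<close> applied to \<open>x p(x y)\<close>. Each zero \<open>- b\<close> of \<open>q\<close> contributes a
  factor to which \<open>bivariate_step\<close> applies, starting from \<open>x p(x y)\<close> itself.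
\<close>

lemma bivariate_nonvanishing:
  fixes p q :: "complex poly"
  assumes \<zeta>: "Re \<zeta> > 0"
    and p: "\<And>z. poly p z = 0 \<Longrightarrow> z \<in> \<real>\<^sub>\<le>\<^sub>0"
    and q: "\<And>z. poly q z = 0 \<Longrightarrow> z \<in> \<real>\<^sub>\<le>\<^sub>0"
    and x: "Re (x / \<zeta>) > 0" and y: "Re (\<zeta> * y) > 0"
  shows "(\<Sum>(i, j)\<in>{..degree p} \<times> {..degree q}. coeff p i * coeff q j
           * poly ((deriv_plus 1 ^^ j) (monom 1 (Suc i))) x
           * poly ((deriv_plus (\<zeta>\<^sup>2) ^^ j) (monom 1 i)) y) \<noteq> 0"
  using q x y
proof (induction "degree q" arbitrary: q x y)
  case 0
  obtain c where c: "q = [:c:]" using 0(1) by (metis degree_eq_zeroE)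
  have "c \<noteq> 0"
    using "0.prems"(1)[of 1] nonpos_Reals_one_I[where 'a = complex] by (auto simp: c)
  have "\<zeta> \<noteq> 0" using \<zeta> by auto
  then have "x * y = (x / \<zeta>) * (\<zeta> * y)" by simp
  then have "x * y \<notin> \<real>\<^sub>\<le>\<^sub>0" using mult_notin_nonpos_Reals[OF 0(3,4)] by simp
  then have nz: "poly p (x * y) \<noteq> 0" using p by blast
  have "x \<noteq> 0" using 0(3) by auto
  have "(\<Sum>(i, j)\<in>{..degree p} \<times> {..degree q}. coeff p i * coeff q j
           * poly ((deriv_plus 1 ^^ j) (monom 1 (Suc i))) x
           * poly ((deriv_plus (\<zeta>\<^sup>2) ^^ j) (monom 1 i)) y)
      = (\<Sum>i\<le>degree p. coeff p i * c * x ^ Suc i * y ^ i)"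
    by (simp add: c poly_monom sum.cartesian_product')
  also have "\<dots> = c * x * poly p (x * y)"
    by (simp add: poly_altdef sum_distrib_left power_mult_distrib mult_ac)
  finally show ?case using \<open>c \<noteq> 0\<close> \<open>x \<noteq> 0\<close> nz by simp
next
  case (Suc n)
  have "\<not> constant (poly q)" using Suc.hyps(2) by (simp add: constant_degree)
  then obtain \<rho> where \<rho>: "poly q \<rho> = 0" using fundamental_theorem_of_algebra by blast
  then have "\<rho> \<in> \<real>\<^sub>\<le>\<^sub>0" by (rule Suc.prems)
  then obtain r where r: "\<rho> = of_real r" "r \<le> 0" by (auto elim: nonpos_Reals_cases)
  define b where "b = - r"
  have b: "b \<ge> 0" "- \<rho> = of_real b" using r by (simp_all add: b_def)
  obtain s where s: "q = [:of_real b, 1:] * s" using \<rho> b(2) by (metis poly_eq_0_iff_dvd dvdE)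
  have s0: "s \<noteq> 0" using Suc.hyps(2) s by auto
  then have "degree q = Suc (degree s)" unfolding s by (subst degree_mult_eq) auto
  then have deg: "n = degree s" using Suc.hyps(2) by simp
  have sz: "z \<in> \<real>\<^sub>\<le>\<^sub>0" if "poly s z = 0" for z
    using Suc.prems(1)[of z] that by (simp add: s)
  let ?C = "\<lambda>j i. (deriv_plus 1 ^^ j) (monom 1 (Suc i)) :: complex poly"
  let ?D = "\<lambda>j i. (deriv_plus (\<zeta>\<^sup>2) ^^ j) (monom 1 i) :: complex poly"
  let ?K = "{..degree p} \<times> {..degree s}"
  have regroup: "(\<Sum>i\<in>I. a i * (\<Sum>j\<in>J. c j * (f (Suc j) i * g (Suc j) i + b * (f j i * g j i))))
      = (\<Sum>k\<in>I \<times> J. (a (fst k) * c (snd k)) * f (Suc (snd k)) (fst k) * g (Suc (snd k)) (fst k))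
        + b * (\<Sum>k\<in>I \<times> J. (a (fst k) * c (snd k)) * f (snd k) (fst k) * g (snd k) (fst k))"
    for a c :: "nat \<Rightarrow> complex" and f g b I J
    by (simp add: sum.cartesian_product' sum_distrib_left sum.distrib distrib_left mult_ac)
  have "(\<Sum>(i, j)\<in>{..degree p} \<times> {..degree q}. coeff p i * coeff q j * poly (?C j i) x * poly (?D j i) y)
      = (\<Sum>i\<le>degree p. coeff p i * (\<Sum>j\<le>degree q. coeff q j * (poly (?C j i) x * poly (?D j i) y)))"
    by (simp add: sum_distrib_left mult_ac sum.cartesian_product')
  also have "\<dots> = (\<Sum>i\<le>degree p. coeff p i * (\<Sum>j\<le>degree s. coeff s j *
      (poly (?C (Suc j) i) x * poly (?D (Suc j) i) y + of_real b * (poly (?C j i) x * poly (?D j i) y))))"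
    unfolding s by (subst sum_coeff_linear_factor_mult) (rule refl)
  also have "\<dots> = (\<Sum>k\<in>?K. (coeff p (fst k) * coeff s (snd k))
          * poly (deriv_plus 1 (?C (snd k) (fst k))) x * poly (deriv_plus (\<zeta>\<^sup>2) (?D (snd k) (fst k))) y)
      + of_real b * (\<Sum>k\<in>?K. (coeff p (fst k) * coeff s (snd k))
          * poly (?C (snd k) (fst k)) x * poly (?D (snd k) (fst k)) y)"
    using regroup[where a = "coeff p" and c = "coeff s" and b = "of_real b" and I = "{..degree p}"
        and J = "{..degree s}" and f = "\<lambda>j i. poly (?C j i) x" and g = "\<lambda>j i. poly (?D j i) y"]
    by (simp only: funpow.simps o_apply)
  also have "\<dots> \<noteq> 0"
  proof (rule bivariate_step[OF _ \<zeta> b(1) Suc.prems(2,3)])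
    fix x y assume "Re (x / \<zeta>) > 0" "Re (\<zeta> * y) > 0"
    from Suc.hyps(1)[OF deg sz this]
    show "(\<Sum>k\<in>?K. (coeff p (fst k) * coeff s (snd k))
          * poly (?C (snd k) (fst k)) x * poly (?D (snd k) (fst k)) y) \<noteq> 0"
      by (simp add: case_prod_unfold)
  qed
  finally show ?case .
qed

text \<open>
  With \<open>\<zeta>\<^sup>2 = w\<close>, the pairing at \<open>w\<close> is \<open>1 + \<partial>\<^sub>x\<close> applied to the polynomial of
  \<open>bivariate_nonvanishing\<close>, taken at \<open>x = w\<close>, \<open>y = 1\<close>. This point is admissible since \<open>x/\<zeta> = \<zeta> y = \<zeta>\<close>.
\<close>

lemma laguerre_pairing_nonvanishing:
  fixes p q :: "complex poly"
  assumes p: "\<And>z. poly p z = 0 \<Longrightarrow> z \<in> \<real>\<^sub>\<le>\<^sub>0"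
    and q: "\<And>z. poly q z = 0 \<Longrightarrow> z \<in> \<real>\<^sub>\<le>\<^sub>0"
    and w: "w \<notin> \<real>\<^sub>\<le>\<^sub>0"
  shows "poly (laguerre_pairing p q) w \<noteq> 0"
proof -
  define \<zeta> where "\<zeta> = csqrt w"
  have w2: "\<zeta>\<^sup>2 = w" by (simp add: \<zeta>_def)
  have \<zeta>: "Re \<zeta> > 0" unfolding \<zeta>_def by (rule Re_csqrt_pos[OF w])
  then have "\<zeta> \<noteq> 0" by auto
  then have w\<zeta>: "w / \<zeta> = \<zeta>" by (simp flip: w2 add: power2_eq_square)
  let ?K = "{..degree p} \<times> {..degree q}"
  let ?C = "\<lambda>k. (deriv_plus 1 ^^ snd k) (monom 1 (Suc (fst k))) :: complex poly"
  let ?D = "\<lambda>k. (deriv_plus w ^^ snd k) (monom 1 (fst k)) :: complex poly"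
  let ?P = "\<Sum>k\<in>?K. smult (coeff p (fst k) * coeff q (snd k) * poly (?D k) 1) (?C k)"
  have "poly (deriv_plus 1 ?P) w \<noteq> 0"
  proof (rule half_plane_deriv_plus(2)[where u = "1 / \<zeta>"])
    fix x assume "Re (1 / \<zeta> * x) > 0"
    then have "Re (x / \<zeta>) > 0" by simp
    from bivariate_nonvanishing[where p = p and q = q, OF \<zeta> p q this, of 1] \<zeta>
    show "poly ?P x \<noteq> 0" by (simp add: poly_sum w2 case_prod_unfold mult_ac)
  qed (use w\<zeta> \<zeta> in simp_all)
  moreover have "poly (deriv_plus 1 ?P) w = poly (laguerre_pairing p q) w"
  proof -
    have "poly (deriv_plus 1 ?P) w
        = (\<Sum>k\<in>?K. coeff p (fst k) * coeff q (snd k) * poly (?D k) 1 * poly (deriv_plus 1 (?C k)) w)"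
      by (rule poly_deriv_plus_sum)
    also have "\<dots> = (\<Sum>k\<in>?K. coeff p (fst k) * coeff q (snd k)
        * (poly (laguerre (Suc (fst k)) (Suc (snd k))) w * poly (laguerre (snd k) (fst k)) w))"
      by (simp add: laguerre_def poly_deriv_plus_funpow_monom_sym[where c = w and d = 1] mult_ac)
    also have "\<dots> = poly (laguerre_pairing p q) w"
      by (simp add: laguerre_pairing_def linear_extension_def poly_sum sum_distrib_left
          sum.cartesian_product' mult_ac)
    finally show ?thesis .
  qed
  ultimately show ?thesis by simp
qed

text \<open>
  The half-plane of all \<open>x\<close> for which \<open>x / csqrt w\<close> has positive real part contains \<open>w\<close> and avoids
  \<open>(-\<infinity>, 0]\<close>, so the pairing has no zeros there.
\<close>

lemma deriv_plus_laguerre_pairing_nonvanishing: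
  fixes p q :: "complex poly"
  assumes p: "\<And>z. poly p z = 0 \<Longrightarrow> z \<in> \<real>\<^sub>\<le>\<^sub>0"
    and q: "\<And>z. poly q z = 0 \<Longrightarrow> z \<in> \<real>\<^sub>\<le>\<^sub>0"
    and w: "w \<notin> \<real>\<^sub>\<le>\<^sub>0"
  shows "poly (deriv_plus 1 (laguerre_pairing p q)) w \<noteq> 0"
proof (rule half_plane_deriv_plus(2)[where u = "1 / csqrt w"])
  have \<zeta>: "Re (csqrt w) > 0" by (rule Re_csqrt_pos[OF w])
  then have "csqrt w \<noteq> 0" by auto
  then have "w / csqrt w = csqrt w"
    using power2_csqrt[of w] by (metis nonzero_mult_div_cancel_left power2_eq_square)
  then show "Re (1 / csqrt w * w) > 0" "Re (1 / (1 / csqrt w)) > 0" using \<zeta> by simp_all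
  fix x assume "Re (1 / csqrt w * x) > 0"
  then have "Re (csqrt w) > 0" "Re (x / csqrt w) > 0" using \<zeta> by simp_all
  then have "csqrt w * (x / csqrt w) \<notin> \<real>\<^sub>\<le>\<^sub>0" by (rule mult_notin_nonpos_Reals)
  moreover have "csqrt w * (x / csqrt w) = x" using \<zeta> by auto
  ultimately show "poly (laguerre_pairing p q) x \<noteq> 0"
    using laguerre_pairing_nonvanishing[where p = p and q = q, OF p q] by simp
qed

section \<open>The umbral map from powers to rising factorials\<close>

definition umbral :: "real poly \<Rightarrow> real poly" where
  "umbral = linear_extension (\<lambda>i. smult ((-1) ^ i) (pochhammer [:0, 1:] i))"

lemma poly_linear_umbral: "poly_linear umbral"
  unfolding umbral_def by (rule poly_linear_linear_extension)

lemma poly_pochhammer_X: "poly (pochhammer [:0, 1:] i) x = pochhammer (x :: real) i"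
  by (induction i) (simp_all add: pochhammer_Suc of_nat_poly algebra_simps)

lemma poly_umbral_monom: "poly (umbral (monom 1 i)) x = (-1) ^ i * pochhammer x i"
  by (simp add: umbral_def linear_extension_monom poly_pochhammer_X)

lemma umbral_one: "umbral 1 = 1"
  by (simp add: umbral_def linear_extension_def)

lemma poly_umbral_0: "poly (umbral p) 0 = coeff p 0"
proof -
  have "poly (umbral p) 0 = (\<Sum>i\<le>degree p. coeff p i * ((-1) ^ i * pochhammer 0 i))"
    by (simp add: umbral_def linear_extension_def poly_sum poly_pochhammer_X mult.assoc)
  also have "\<dots> = (\<Sum>i\<in>{0}. coeff p i * ((-1) ^ i * pochhammer 0 i))"
    by (rule sum.mono_neutral_right) (auto simp: pochhammer_0_left)
  finally show ?thesis by simp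
qed

text \<open>
  The rising factorials have distinct degrees, so the leading coefficient survives.
\<close>

lemma umbral_eq_0D:
  assumes "umbral p = 0"
  shows "p = 0"
proof -
  let ?n = "degree p"
  have "coeff (umbral p) ?n
      = (\<Sum>i\<le>?n. coeff p i * ((-1) ^ i * coeff (pochhammer [:0, 1:] i) ?n))"
    by (simp add: umbral_def linear_extension_def coeff_sum mult.assoc)
  also have "\<dots> = (\<Sum>i\<in>{?n}. coeff p i * ((-1) ^ i * coeff (pochhammer [:0, 1:] i) ?n))"
    by (rule sum.mono_neutral_right) (auto simp: coeff_eq_0 degree_pochhammer_X)
  finally have "coeff (umbral p) ?n = (-1) ^ ?n * lead_coeff p"
    by (simp add: lead_coeff_pochhammer_X)
  then show ?thesis using assms by simp
qed

lemma umbral_eqI: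
  assumes "\<And>k::nat. poly (umbral p) (of_nat k) = poly (umbral q) (of_nat k)"
  shows "p = q"
proof -
  have "umbral p = umbral q" using assms by (rule poly_eq_of_nat)
  then have "umbral (p + smult (-1) q) = 0"
    unfolding poly_linear_add[OF poly_linear_umbral] poly_linear_smult[OF poly_linear_umbral] by simp
  then have "p + smult (-1) q = 0" by (rule umbral_eq_0D)
  then show ?thesis by simp
qed

text \<open>
  This corresponds to \<open>x \<langle>x\<rangle>\<^sub>i = \<langle>x\<rangle>\<^bsub>i+1\<^esub> - i \<langle>x\<rangle>\<^sub>i\<close> for rising factorials. It produces the
  preimages of the powers of \<open>- x\<close>, visibly with nonnegative coefficients.
\<close>

lemma umbral_X_mult_deriv_plus: "umbral ([:0, 1:] * deriv_plus 1 p) = [:0, -1:] * umbral p"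
proof (rule poly_linear_eqI[where p = p])
  show "poly_linear (\<lambda>p. umbral ([:0, 1:] * deriv_plus 1 p))"
    by (intro poly_linear_comp[OF poly_linear_umbral] poly_linear_mult poly_linear_deriv_plus)
  show "poly_linear (\<lambda>p. [:0, -1:] * umbral p)"
    by (intro poly_linear_mult poly_linear_umbral)
  fix i
  have eq: "[:0, 1:] * deriv_plus 1 (monom 1 i) = monom 1 (Suc i) + smult (of_nat i) (monom (1::real) i)"
    unfolding deriv_plus_def distrib_left X_pderiv_monom by (simp add: monom_Suc of_nat_poly)
  have "poly (umbral ([:0, 1:] * deriv_plus 1 (monom 1 i))) x = poly ([:0, -1:] * umbral (monom 1 i)) x"
    for x :: real
    unfolding eq poly_linear_add[OF poly_linear_umbral] poly_linear_smult[OF poly_linear_umbral]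
    by (simp add: poly_umbral_monom pochhammer_Suc algebra_simps)
  then show "umbral ([:0, 1:] * deriv_plus 1 (monom 1 i)) = [:0, -1:] * umbral (monom 1 i)"
    by (simp add: poly_eq_poly_eq_iff[symmetric] fun_eq_iff)
qed

lemma join_vertex_monom:
  "join_vertex (monom 1 i) = monom 1 (Suc i) + smult (of_nat (2 * i)) (monom 1 i)
     + smult (of_nat (i * (i - 1))) (monom (1::'a::field_char_0) (i - 1))"
proof (cases i)
  case 0
  then show ?thesis by (simp add: join_vertex_def deriv_plus_def monom_Suc monom_0 pderiv_1 pCons_one)
next
  case (Suc k)
  show ?thesis
  proof (cases k)
    case 0
    then show ?thesis using Suc
      by (simp add: join_vertex_def deriv_plus_def monom_Suc monom_0 pderiv_pCons)
  next
    case (Suc l)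
    then show ?thesis using \<open>i = Suc k\<close>
      by (simp add: join_vertex_def deriv_plus_def monom_Suc[symmetric] pderiv_add pderiv_monom
          smult_monom add_monom mult_2 algebra_simps)
  qed
qed

lemma poly_linear_join_vertex: "poly_linear join_vertex"
  unfolding join_vertex_def
  by (intro poly_linear_mult poly_linear_comp[OF poly_linear_deriv_plus] poly_linear_deriv_plus)

text \<open>
  If \<open>umbral p\<close> is \<open>\<plusminus> \<chi>\<close> for some graph, then \<open>x \<chi>(x - 1)\<close> on the right-hand side is the chromatic polynomial
  of its join with a vertex: choose the colour of the vertex and colour the rest without it.
\<close>

lemma poly_umbral_join_vertex:
  "poly (umbral (join_vertex p)) x = - x * poly (umbral p) (x - 1)"
proof -
  have "umbral (join_vertex p) = [:0, -1:] * pcompose (umbral p) [:-1, 1:]"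
  proof (rule poly_linear_eqI[where p = p])
    show "poly_linear (\<lambda>p. umbral (join_vertex p))"
      by (intro poly_linear_comp[OF poly_linear_umbral] poly_linear_join_vertex)
    have "poly_linear (\<lambda>p. pcompose p [:-1, 1:])"
      by (simp add: poly_linear_def pcompose_add pcompose_smult)
    then show "poly_linear (\<lambda>p. [:0, -1:] * pcompose (umbral p) [:-1, 1:])"
      by (intro poly_linear_mult poly_linear_comp[OF _ poly_linear_umbral])
    fix i
    have "poly (umbral (join_vertex (monom 1 i))) x
        = poly ([:0, -1:] * pcompose (umbral (monom 1 i)) [:-1, 1:]) x" for x :: real
    proof -
      have l: "poly (umbral (join_vertex (monom 1 i))) x = (-1) ^ Suc i * pochhammer x (Suc i)
          + of_nat (2 * i) * ((-1) ^ i * pochhammer x i)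
          + of_nat (i * (i - 1)) * ((-1) ^ (i - 1) * pochhammer x (i - 1))"
        unfolding join_vertex_monom poly_linear_add[OF poly_linear_umbral]
          poly_linear_smult[OF poly_linear_umbral]
        by (simp only: poly_add poly_smult poly_umbral_monom)
      have r: "poly ([:0, -1:] * pcompose (umbral (monom 1 i)) [:-1, 1:]) x
          = - x * ((-1) ^ i * pochhammer (x - 1) i)"
        by (simp add: poly_pcompose poly_umbral_monom)
      show ?thesis
      proof (cases i)
        case 0
        then show ?thesis unfolding l r by simp
      next
        case (Suc k)
        have e1: "pochhammer (x - 1) (Suc k) = (x - 1) * pochhammer x k"
          by (simp add: pochhammer_rec)
        have e2: "pochhammer x (Suc k) = pochhammer x k * (x + of_nat k)"
          by (rule pochhammer_Suc)
        have e3: "pochhammer x (Suc (Suc k)) = pochhammer x k * (x + of_nat k) * (x + of_nat k + 1)"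
          by (simp add: pochhammer_Suc add.assoc)
        show ?thesis unfolding l r unfolding Suc diff_Suc_1 e3 unfolding e1 e2
          by (simp add: algebra_simps)
      qed
    qed
    then show "umbral (join_vertex (monom 1 i)) = [:0, -1:] * pcompose (umbral (monom 1 i)) [:-1, 1:]"
      by (simp add: poly_eq_poly_eq_iff[symmetric] fun_eq_iff)
  qed
  then show ?thesis by (simp add: poly_pcompose)
qed

text \<open>
  Choosing an ordered \<open>i\<close>-tuple of distinct colours leaves \<open>k - i\<close> colours. For \<open>k < i\<close> there
  is no such tuple and both sides are \<open>0\<close>.
\<close>

lemma poly_umbral_join_vertex_funpow:
  "poly (umbral ((join_vertex ^^ i) p)) (of_nat k)
     = (-1) ^ i * fact i * of_nat (k choose i) * poly (umbral p) (of_nat (k - i))"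
proof (induction i arbitrary: k)
  case (Suc i)
  show ?case
  proof (cases k)
    case 0
    then show ?thesis by (simp add: poly_umbral_join_vertex)
  next
    case (Suc m)
    have bin: "of_nat (Suc m) * of_nat (m choose i) = (of_nat (Suc i) * of_nat (Suc m choose Suc i) :: real)"
      by (simp only: of_nat_mult[symmetric] Suc_times_binomial)
    have "poly (umbral ((join_vertex ^^ Suc i) p)) (of_nat k)
        = - of_nat (Suc m) * poly (umbral ((join_vertex ^^ i) p)) (of_nat m)"
      by (simp add: poly_umbral_join_vertex Suc)
    also have "\<dots> = - ((-1) ^ i * fact i * (of_nat (Suc m) * of_nat (m choose i))
        * poly (umbral p) (of_nat (m - i)))"
      unfolding Suc.IH by (simp del: of_nat_Suc)
    finally show ?thesis unfolding bin Suc by (simp add: algebra_simps del: of_nat_Suc binomial_Suc_Suc)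
  qed
qed simp

lemma poly_umbral_sum_join_vertex_funpow:
  "poly (umbral (\<Sum>i\<in>I. smult ((-1) ^ i * a i / fact i) ((join_vertex ^^ i) p))) (of_nat k)
     = (\<Sum>i\<in>I. of_nat (k choose i) * a i * poly (umbral p) (of_nat (k - i)))"
  by (simp add: poly_linear_sum[OF poly_linear_umbral] poly_linear_smult[OF poly_linear_umbral]
      poly_sum poly_umbral_join_vertex_funpow flip: power_mult_distrib)
    (auto intro!: sum.cong simp flip: power_mult_distrib)

section \<open>The \<open>\<tau>\<close>-polynomial and its signs\<close>

lemma umbral_tau_poly:
  assumes "pair_graph G"
  shows "umbral (tau_poly G) = smult ((-1) ^ card (pverts G)) (chromatic_poly G)"
proof -
  let ?n = "card (pverts G)"
  have "umbral (tau_poly G) = (\<Sum>i\<le>?n. umbral (smult (tau_coeff G i) (monom 1 i)))"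
    by (simp add: tau_poly_def poly_linear_sum[OF poly_linear_umbral] smult_monom)
  also have "\<dots> = (\<Sum>i\<le>?n. smult (tau_coeff G i * (-1) ^ i) (pochhammer [:0, 1:] i))"
    unfolding poly_linear_smult[OF poly_linear_umbral]
    by (simp add: umbral_def linear_extension_monom)
  also have "\<dots> = (\<Sum>i\<le>?n. smult ((-1) ^ ?n) (smult ((-1) ^ (?n - i) * tau_coeff G i)
      (pochhammer [:0, 1:] i)))"
  proof (intro sum.cong refl)
    fix i assume "i \<in> {..?n}"
    then have "(-1::real) ^ ?n = (-1) ^ (?n - i) * (-1) ^ i" by (simp flip: power_add)
    then have "(-1::real) ^ ?n * (-1) ^ (?n - i) = (-1) ^ i"
      by (simp add: mult.assoc[symmetric] flip: power_mult_distrib)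
    then show "smult (tau_coeff G i * (-1) ^ i) (pochhammer [:0, 1:] i)
        = smult ((-1) ^ ?n) (smult ((-1) ^ (?n - i) * tau_coeff G i) (pochhammer [:0, 1:] i))"
      by (simp add: mult_ac flip: mult.assoc)
  qed
  also have "\<dots> = smult ((-1) ^ ?n) (chromatic_poly G)"
    by (subst tau_coeff_props(2)[OF assms]) (simp add: smult_sum_right)
  finally show ?thesis .
qed

lemma poly_umbral_tau_poly:
  assumes "pair_graph G"
  shows "poly (umbral (tau_poly G)) (of_nat k)
           = (-1) ^ card (pverts G) * of_nat (card (proper_colorings G k))"
  by (simp add: umbral_tau_poly[OF assms] poly_chromatic_poly[OF assms])

text \<open>
  Deletion and contraction are carried out on lists of pairs, since a contraction may create loops and parallel
  edges; a loop leaves no colouring at all.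
\<close>

definition colorings_avoiding :: "'a set \<Rightarrow> ('a \<times> 'a) list \<Rightarrow> nat \<Rightarrow> ('a \<Rightarrow> nat) set" where
  "colorings_avoiding V E k = {f \<in> V \<rightarrow>\<^sub>E {..<k}. \<forall>(u, v) \<in> set E. f u \<noteq> f v}"

lemma finite_colorings_avoiding: "finite V \<Longrightarrow> finite (colorings_avoiding V E k)"
  by (rule finite_subset[of _ "V \<rightarrow>\<^sub>E {..<k}"]) (auto simp: colorings_avoiding_def intro: finite_PiE)

text \<open>
  Restricting to \<open>V - {v}\<close> loses nothing, since the colour of \<open>v\<close> can be read off at \<open>u\<close>.
\<close>

lemma card_colorings_contraction:
  fixes u v :: 'a
  assumes "u \<in> V" "v \<in> V" "u \<noteq> v" "set E \<subseteq> V \<times> V"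
  defines "r \<equiv> \<lambda>a. if a = v then u else a"
  shows "card {f \<in> colorings_avoiding V E k. f u = f v}
           = card (colorings_avoiding (V - {v}) (map (map_prod r r) E) k)"
proof (rule bij_betw_same_card[of "\<lambda>f. restrict f (V - {v})"], rule bij_betw_byWitness[where f' = "\<lambda>g. g(v := g u)"])
  show "\<forall>f\<in>{f \<in> colorings_avoiding V E k. f u = f v}.
          (restrict f (V - {v}))(v := restrict f (V - {v}) u) = f"
    using assms by (auto simp: colorings_avoiding_def fun_eq_iff restrict_def PiE_def extensional_def)
  show "\<forall>g\<in>colorings_avoiding (V - {v}) (map (map_prod r r) E) k.
          restrict (g(v := g u)) (V - {v}) = g"
    by (auto simp: colorings_avoiding_def fun_eq_iff restrict_def PiE_def extensional_def)
  show "(\<lambda>f. restrict f (V - {v})) ` {f \<in> colorings_avoiding V E k. f u = f v}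
          \<subseteq> colorings_avoiding (V - {v}) (map (map_prod r r) E) k"
  proof (rule image_subsetI)
    fix f assume f: "f \<in> {f \<in> colorings_avoiding V E k. f u = f v}"
    have eq: "restrict f (V - {v}) (r a) = f a" if "a \<in> V" for a
      using that f assms by (auto simp: r_def)
    have "restrict f (V - {v}) (r a) \<noteq> restrict f (V - {v}) (r b)" if "(a, b) \<in> set E" for a b
    proof -
      have "f a \<noteq> f b" "a \<in> V" "b \<in> V"
        using that f assms(4) by (auto simp: colorings_avoiding_def)
      then show ?thesis by (simp only: eq not_False_eq_True)
    qed
    moreover have "restrict f (V - {v}) \<in> V - {v} \<rightarrow>\<^sub>E {..<k}"
      using f by (auto simp: colorings_avoiding_def)
    ultimately show "restrict f (V - {v}) \<in> colorings_avoiding (V - {v}) (map (map_prod r r) E) k"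
      unfolding colorings_avoiding_def by (auto simp del: restrict_apply)
  qed
  show "(\<lambda>g. g(v := g u)) ` colorings_avoiding (V - {v}) (map (map_prod r r) E) k
          \<subseteq> {f \<in> colorings_avoiding V E k. f u = f v}"
  proof (rule image_subsetI)
    fix g assume g: "g \<in> colorings_avoiding (V - {v}) (map (map_prod r r) E) k"
    have "(g(v := g u)) a = g (r a)" for a
      by (simp add: r_def)
    moreover have "g(v := g u) \<in> V \<rightarrow>\<^sub>E {..<k}"
      using g assms(1-3) by (auto simp: colorings_avoiding_def PiE_def Pi_def extensional_def)
    moreover have "\<forall>(a, b)\<in>set E. g (r a) \<noteq> g (r b)"
      using g by (fastforce simp: colorings_avoiding_def)
    ultimately show "g(v := g u) \<in> {f \<in> colorings_avoiding V E k. f u = f v}"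
      using assms(3) unfolding colorings_avoiding_def by auto
  qed
qed

text \<open>
  Deleting the edge \<open>uv\<close> adds the colourings with equal colours at \<open>u\<close> and \<open>v\<close>, which live on one vertex
  less. The sign \<open>(-1)^card V\<close> turns the resulting difference into a sum, so nonnegative coefficients are
  inherited from the edgeless graphs.
\<close>

lemma colorings_avoiding_nonneg_coeffs:
  assumes "finite V" "set E \<subseteq> V \<times> V"
  shows "\<exists>p. (\<forall>i. coeff p i \<ge> 0) \<and>
    (\<forall>k::nat. poly (umbral p) (of_nat k) = (-1) ^ card V * of_nat (card (colorings_avoiding V E k)))"
  using assms
proof (induction "length E" arbitrary: V E)
  case 0
  define p :: "real poly" where "p = ((\<lambda>p. [:0, 1:] * deriv_plus 1 p) ^^ card V) 1"
  have "coeff (((\<lambda>p. [:0, 1:] * deriv_plus 1 p) ^^ n) 1) i \<ge> (0 :: real)" for n i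
  proof (induction n arbitrary: i)
    case (Suc n)
    then show ?case
      by (cases i) (auto simp: deriv_plus_def coeff_pderiv)
  qed (simp add: coeff_1)
  moreover have "poly (umbral (((\<lambda>p. [:0, 1:] * deriv_plus 1 p) ^^ n) 1)) x = (-1) ^ n * x ^ n"
    for n and x :: real
  proof (induction n)
    case (Suc n)
    then show ?case unfolding funpow.simps o_apply umbral_X_mult_deriv_plus by simp
  qed (simp add: umbral_one)
  moreover have "card (colorings_avoiding V E k) = k ^ card V" for k
    using 0 by (simp add: colorings_avoiding_def card_PiE)
  ultimately show ?case by (intro exI[of _ p]) (simp add: p_def)
next
  case (Suc n E')
  obtain u v E where E': "E' = (u, v) # E" using Suc.hyps(2) by (cases E') auto
  have uv: "u \<in> V" "v \<in> V" "set E \<subseteq> V \<times> V" using Suc.prems E' by auto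
  have n: "n = length E" using Suc.hyps(2) E' by simp
  show ?case
  proof (cases "u = v")
    case True
    then have "colorings_avoiding V E' k = {}" for k
      by (auto simp: colorings_avoiding_def E')
    then show ?thesis by (intro exI[of _ 0]) (simp add: poly_linear_0[OF poly_linear_umbral])
  next
    case False
    let ?F = "map (map_prod (\<lambda>a. if a = v then u else a) (\<lambda>a. if a = v then u else a)) E"
    obtain p where p: "\<And>i. coeff p i \<ge> 0"
      "\<And>k::nat. poly (umbral p) (of_nat k) = (-1) ^ card V * of_nat (card (colorings_avoiding V E k))"
      using Suc.hyps(1)[OF n Suc.prems(1) uv(3)] by blast
    have "set ?F \<subseteq> (V - {v}) \<times> (V - {v})" using uv False by (auto split: if_splits)
    then obtain q where q: "\<And>i. coeff q i \<ge> 0"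
      "\<And>k::nat. poly (umbral q) (of_nat k)
          = (-1) ^ card (V - {v}) * of_nat (card (colorings_avoiding (V - {v}) ?F k))"
      using Suc.hyps(1)[of ?F "V - {v}"] n Suc.prems(1) by auto
    have "poly (umbral (p + q)) (of_nat k)
        = (-1) ^ card V * of_nat (card (colorings_avoiding V E' k))" for k :: nat
    proof -
      let ?A = "colorings_avoiding V E k" and ?B = "{f \<in> colorings_avoiding V E k. f u = f v}"
      have fin: "finite ?A" using Suc.prems(1) by (rule finite_colorings_avoiding)
      have "colorings_avoiding V E' k = ?A - ?B"
        by (auto simp: colorings_avoiding_def E')
      then have "card (colorings_avoiding V E' k) = card ?A - card ?B"
        using fin by (simp add: card_Diff_subset)
      moreover have "card ?B \<le> card ?A" using fin by (intro card_mono) auto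
      moreover have "card ?B = card (colorings_avoiding (V - {v}) ?F k)"
        by (rule card_colorings_contraction[OF uv(1,2) False uv(3)])
      moreover have "card V = Suc (card (V - {v}))"
        using uv Suc.prems(1) by (intro card.remove)
      ultimately show ?thesis
        by (simp add: poly_linear_add[OF poly_linear_umbral] p q of_nat_diff algebra_simps)
    qed
    then show ?thesis using p(1) q(1) by (intro exI[of _ "p + q"]) auto
  qed
qed

lemma coeff_tau_poly_nonneg:
  assumes "pair_graph G"
  shows "coeff (tau_poly G) i \<ge> 0"
proof -
  interpret G: pair_graph G by fact
  obtain E where E: "set E = parcs G" using finite_list G.pair_finite_arcs by blast
  have "set E \<subseteq> pverts G \<times> pverts G" using G.wellformed' E by auto
  then obtain p where p: "\<And>i. coeff p i \<ge> 0"
    "\<And>k::nat. poly (umbral p) (of_nat k)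
        = (-1) ^ card (pverts G) * of_nat (card (colorings_avoiding (pverts G) E k))"
    using colorings_avoiding_nonneg_coeffs G.pair_finite_verts by blast
  have "tau_poly G = p"
    using p(2) by (intro umbral_eqI)
      (simp add: poly_umbral_tau_poly[OF assms] colorings_avoiding_def proper_colorings_def E)
  then show ?thesis using p(1) by simp
qed

text \<open>
  At \<open>0\<close> all rising factorials but the empty one vanish, so up to sign the constant coefficient is the
  number of colourings without any colour.
\<close>

lemma coeff_tau_poly_0:
  assumes "pair_graph G" "pverts G \<noteq> {}"
  shows "coeff (tau_poly G) 0 = 0"
proof -
  have "proper_colorings G 0 = {}" using assms(2) by (auto simp: proper_colorings_def)
  then show ?thesis
    using poly_umbral_tau_poly[OF assms(1), of 0] by (simp add: poly_umbral_0)
qed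

section \<open>Colourings of a join\<close>

definition colorings_in :: "'a pair_pre_digraph \<Rightarrow> nat set \<Rightarrow> ('a \<Rightarrow> nat) set" where
  "colorings_in G T = {f \<in> pverts G \<rightarrow>\<^sub>E T. \<forall>(u, v) \<in> parcs G. f u \<noteq> f v}"

lemma card_colorings_in:
  assumes "pair_graph G" "finite T"
  shows "card (colorings_in G T) = card (proper_colorings G (card T))"
proof -
  interpret G: pair_graph G by fact
  obtain h where h: "bij_betw h T {..<card T}"
    using finite_same_card_bij[OF assms(2), of "{..<card T}"] by auto
  let ?h' = "the_inv_into T h"
  have inv: "?h' (h a) = a" if "a \<in> T" for a
    using h that by (simp add: bij_betw_def the_inv_into_f_f)
  have inv': "h (?h' b) = b" "?h' b \<in> T" if "b < card T" for b
    using h that by (auto simp: bij_betw_def f_the_inv_into_f the_inv_into_into)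
  have hT: "h a < card T" if "a \<in> T" for a using h that by (auto simp: bij_betw_def)
  have V: "u \<in> pverts G" "v \<in> pverts G" if "(u, v) \<in> parcs G" for u v
    using G.wellformed'[OF that] by auto
  show ?thesis
  proof (rule bij_betw_same_card[of "\<lambda>f. restrict (h \<circ> f) (pverts G)"],
      rule bij_betw_byWitness[where f' = "\<lambda>g. restrict (?h' \<circ> g) (pverts G)"])
    show "\<forall>f\<in>colorings_in G T. restrict (?h' \<circ> restrict (h \<circ> f) (pverts G)) (pverts G) = f"
      by (auto simp: colorings_in_def fun_eq_iff restrict_def PiE_def extensional_def Pi_def inv)
    show "\<forall>g\<in>proper_colorings G (card T).
            restrict (h \<circ> restrict (?h' \<circ> g) (pverts G)) (pverts G) = g"
      by (auto simp: proper_colorings_def fun_eq_iff restrict_def PiE_def extensional_def Pi_def inv')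
    show "(\<lambda>f. restrict (h \<circ> f) (pverts G)) ` colorings_in G T \<subseteq> proper_colorings G (card T)"
    proof (rule image_subsetI)
      fix f assume f: "f \<in> colorings_in G T"
      have "h (f u) \<noteq> h (f v)" if "(u, v) \<in> parcs G" for u v
      proof
        assume "h (f u) = h (f v)"
        moreover have "f u \<in> T" "f v \<in> T" using f V[OF that] by (auto simp: colorings_in_def)
        ultimately have "f u = f v" using inv by metis
        then show False using f that by (auto simp: colorings_in_def)
      qed
      moreover have "h (f v) < card T" if "v \<in> pverts G" for v
        using f that by (intro hT) (auto simp: colorings_in_def)
      ultimately show "restrict (h \<circ> f) (pverts G) \<in> proper_colorings G (card T)"
        using V by (auto simp: colorings_in_def proper_colorings_def)
    qed
    show "(\<lambda>g. restrict (?h' \<circ> g) (pverts G)) ` proper_colorings G (card T) \<subseteq> colorings_in G T"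
    proof (rule image_subsetI)
      fix g assume g: "g \<in> proper_colorings G (card T)"
      have "?h' (g u) \<noteq> ?h' (g v)" if "(u, v) \<in> parcs G" for u v
      proof
        assume "?h' (g u) = ?h' (g v)"
        moreover have "g u < card T" "g v < card T" using g V[OF that] by (auto simp: proper_colorings_def)
        ultimately have "g u = g v" using inv'(1) by metis
        then show False using g that by (auto simp: proper_colorings_def)
      qed
      moreover have "?h' (g v) \<in> T" if "v \<in> pverts G" for v
        using g that by (intro inv'(2)) (auto simp: proper_colorings_def)
      ultimately show "restrict (?h' \<circ> g) (pverts G) \<in> colorings_in G T"
        using V by (auto simp: colorings_in_def proper_colorings_def)
    qed
  qed
qed

lemma proper_coloringsI:
  "f \<in> pverts G \<rightarrow>\<^sub>E {..<k} \<Longrightarrow> (\<And>u v. (u, v) \<in> parcs G \<Longrightarrow> f u \<noteq> f v) \<Longrightarrow> f \<in> proper_colorings G k"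
  by (auto simp: proper_colorings_def)

text \<open>
  The colour sets of the two sides of a join are disjoint, so a colouring is a surjective colouring of \<open>G\<close>
  onto \<open>S\<close> together with a colouring of \<open>H\<close> by the remaining colours.
\<close>

lemma card_join_colorings_fixed_image:
  assumes "pair_graph G" "pair_graph H" "pverts G \<inter> pverts H = {}" "S \<subseteq> {..<k}"
  shows "card {f \<in> proper_colorings (graph_join G H) k. f ` pverts G = S}
           = card (onto_colorings G S) * card (colorings_in H ({..<k} - S))"
proof -
  interpret G: pair_graph G by fact
  interpret H: pair_graph H by fact
  have VG: "u \<in> pverts G" "v \<in> pverts G" if "(u, v) \<in> parcs G" for u v
    using G.wellformed'[OF that] by auto
  have VH: "u \<in> pverts H" "v \<in> pverts H" if "(u, v) \<in> parcs H" for u v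
    using H.wellformed'[OF that] by auto
  let ?L = "{f \<in> proper_colorings (graph_join G H) k. f ` pverts G = S}"
  let ?R = "onto_colorings G S \<times> colorings_in H ({..<k} - S)"
  let ?glue = "\<lambda>(g, h) v. if v \<in> pverts G then g v else (h :: 'a \<Rightarrow> nat) v"
  have "bij_betw (\<lambda>f. (restrict f (pverts G), restrict f (pverts H))) ?L ?R"
  proof (rule bij_betw_byWitness[where f' = ?glue])
    show "\<forall>f\<in>?L. ?glue (restrict f (pverts G), restrict f (pverts H)) = f"
      by (auto simp: proper_colorings_def graph_join_def fun_eq_iff restrict_def PiE_def extensional_def)
    show "\<forall>p\<in>?R. (restrict (?glue p) (pverts G), restrict (?glue p) (pverts H)) = p"
      using assms(3)
      by (auto simp: onto_colorings_def colorings_in_def fun_eq_iff restrict_def PiE_def extensional_def)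
    show "(\<lambda>f. (restrict f (pverts G), restrict f (pverts H))) ` ?L \<subseteq> ?R"
    proof (rule image_subsetI)
      fix f assume f: "f \<in> ?L"
      have arc: "f u \<noteq> f v" if "(u, v) \<in> parcs (graph_join G H)" for u v
        using f that by (auto simp: proper_colorings_def)
      have range: "f v \<in> {..<k}" if "v \<in> pverts G \<union> pverts H" for v
        using f that by (auto simp: proper_colorings_def graph_join_def)
      have cross: "f v \<notin> S" if "v \<in> pverts H" for v
      proof
        assume "f v \<in> S"
        then obtain u where "u \<in> pverts G" "f u = f v" using f by auto
        then show False using arc[of u v] that by (auto simp: graph_join_def)
      qed
      have "restrict f (pverts G) \<in> onto_colorings G S"
        using f VG arc by (auto simp: onto_colorings_def graph_join_def)
      moreover have "restrict f (pverts H) \<in> colorings_in H ({..<k} - S)"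
        using VH cross arc range by (auto simp: colorings_in_def graph_join_def)
      ultimately show "(restrict f (pverts G), restrict f (pverts H)) \<in> ?R" by simp
    qed
    show "?glue ` ?R \<subseteq> ?L"
    proof (rule image_subsetI)
      fix p assume "p \<in> ?R"
      then obtain g h where p: "p = (g, h)" and g: "g \<in> onto_colorings G S"
        and h: "h \<in> colorings_in H ({..<k} - S)" by auto
      let ?f = "?glue (g, h)"
      have fG: "?f v = g v" if "v \<in> pverts G" for v using that by simp
      have fH: "?f v = h v" if "v \<in> pverts H" for v using that assms(3) by auto
      have gS: "g v \<in> S" if "v \<in> pverts G" for v using g that by (auto simp: onto_colorings_def)
      have hS: "h v \<in> {..<k} - S" if "v \<in> pverts H" for v using h that by (auto simp: colorings_in_def)
      have "?f \<in> pverts G \<union> pverts H \<rightarrow>\<^sub>E {..<k}"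
      proof (rule PiE_I)
        fix v assume v: "v \<in> pverts G \<union> pverts H"
        show "?f v \<in> {..<k}"
        proof (cases "v \<in> pverts G")
          case True
          then show ?thesis using gS[OF True] assms(4) by auto
        next
          case False
          then show ?thesis using hS v by auto
        qed
      next
        fix v assume "v \<notin> pverts G \<union> pverts H"
        then show "?f v = undefined" using h by (auto simp: colorings_in_def PiE_def extensional_def)
      qed
      moreover have "?f u \<noteq> ?f v" if uv: "(u, v) \<in> parcs (graph_join G H)" for u v
      proof -
        consider "(u, v) \<in> parcs G" | "(u, v) \<in> parcs H" | "u \<in> pverts G" "v \<in> pverts H"
          | "u \<in> pverts H" "v \<in> pverts G"
          using uv by (auto simp: graph_join_def)
        then show ?thesis
        proof cases
          case 1
          then show ?thesis using VG[OF 1] g by (auto simp: onto_colorings_def)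
        next
          case 2
          then show ?thesis using fH VH[OF 2] h by (auto simp: colorings_in_def)
        next
          case 3
          then show ?thesis using fH[of v] gS[of u] hS[of v] by force
        next
          case 4
          then show ?thesis using fH[of u] gS[of v] hS[of u] by force
        qed
      qed
      ultimately have "?f \<in> proper_colorings (graph_join G H) k"
      proof (intro proper_coloringsI)
        assume "?f \<in> pverts G \<union> pverts H \<rightarrow>\<^sub>E {..<k}"
        then show "?f \<in> pverts (graph_join G H) \<rightarrow>\<^sub>E {..<k}" by (simp add: graph_join_def)
      qed blast
      moreover have "?f ` pverts G = S"
        using g by (auto simp: onto_colorings_def)
      ultimately show "?glue p \<in> ?L" unfolding p by blast
    qed
  qed
  then show ?thesis by (simp add: bij_betw_same_card card_cartesian_product)
qed

lemma sum_Pow_card: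
  assumes "finite A"
  shows "(\<Sum>S\<in>Pow A. F (card S)) = (\<Sum>j\<le>card A. (card A choose j) * (F j :: nat))"
proof -
  have "(\<Sum>S\<in>Pow A. F (card S)) = (\<Sum>j\<le>card A. \<Sum>S\<in>{S \<in> Pow A. card S = j}. F (card S))"
    using assms by (intro sum.group[symmetric]) (auto simp: card_mono)
  also have "\<dots> = (\<Sum>j\<le>card A. (card A choose j) * F j)"
    using n_subsets[OF assms] by (intro sum.cong refl) simp
  finally show ?thesis .
qed

lemma card_proper_colorings_join:
  assumes "pair_graph G" "pair_graph H" "pverts G \<inter> pverts H = {}"
  shows "card (proper_colorings (graph_join G H) k)
    = (\<Sum>j\<le>card (pverts G). (k choose j) * (card (onto_colorings G {..<j}) * card (proper_colorings H (k - j))))"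
proof -
  interpret G: pair_graph G by fact
  let ?n = "card (pverts G)"
  let ?J = "proper_colorings (graph_join G H) k"
  let ?F = "\<lambda>j. card (onto_colorings G {..<j}) * card (proper_colorings H (k - j))"
  have fin: "finite ?J"
  proof -
    interpret J: pair_graph "graph_join G H" by (rule pair_graph_graph_join[OF assms])
    have "finite (pverts (graph_join G H) \<rightarrow>\<^sub>E {..<k})"
      using J.pair_finite_verts by (intro finite_PiE) auto
    then show ?thesis by (simp add: proper_colorings_def)
  qed
  have un: "?J = (\<Union>S\<in>Pow {..<k}. {f \<in> ?J. f ` pverts G = S})"
    by (auto simp: proper_colorings_def graph_join_def)
  have "card ?J = (\<Sum>S\<in>Pow {..<k}. card {f \<in> ?J. f ` pverts G = S})"
    by (subst un, rule card_UN_disjoint) (use fin in auto)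
  also have "\<dots> = (\<Sum>S\<in>Pow {..<k}. ?F (card S))"
  proof (intro sum.cong refl)
    fix S assume "S \<in> Pow {..<k}"
    then have S: "S \<subseteq> {..<k}" "finite S" by (auto intro: finite_subset)
    have "card (onto_colorings G S) = card (onto_colorings G {..<card S})"
      using S by (intro card_onto_colorings_eq assms) auto
    moreover have "card (colorings_in H ({..<k} - S)) = card (proper_colorings H (k - card S))"
      using S by (simp add: card_colorings_in[OF assms(2)] card_Diff_subset)
    ultimately show "card {f \<in> ?J. f ` pverts G = S} = ?F (card S)"
      using card_join_colorings_fixed_image[OF assms S(1)] by simp
  qed
  also have "\<dots> = (\<Sum>j\<le>k. (k choose j) * ?F j)"
    using sum_Pow_card[of "{..<k}" ?F] by simp
  also have "\<dots> = (\<Sum>j\<le>max k ?n. (k choose j) * ?F j)"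
    by (rule sum.mono_neutral_left) auto
  also have "\<dots> = (\<Sum>j\<le>?n. (k choose j) * ?F j)"
    by (rule sum.mono_neutral_right) (auto simp: onto_colorings_empty)
  finally show ?thesis .
qed

section \<open>The \<open>\<tau>\<close>-polynomial of a join\<close>

text \<open>
  The coefficients of the polynomial in \<open>join_vertex\<close> that yields \<open>\<tau>\<^sub>G\<close> from \<open>1\<close>. Up to sign, the weight of
  \<open>i\<close> is the number of partitions of the vertices into \<open>i\<close> independent sets.
\<close>

definition surjective_weight :: "'a pair_pre_digraph \<Rightarrow> nat \<Rightarrow> real" where
  "surjective_weight G i =
     (-1) ^ card (pverts G) * ((-1) ^ i * of_nat (card (onto_colorings G {..<i})) / fact i)"

lemma tau_poly_eq_sum_join_vertex:
  assumes "pair_graph G"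
  shows "tau_poly G = (\<Sum>i\<le>card (pverts G). smult (surjective_weight G i) ((join_vertex ^^ i) 1))"
proof (rule umbral_eqI)
  fix k :: nat
  let ?a = "\<lambda>i. (-1) ^ card (pverts G) * real (card (onto_colorings G {..<i}))"
  have "poly (umbral (tau_poly G)) (of_nat k)
      = (\<Sum>i\<le>card (pverts G). of_nat (k choose i) * ?a i * poly (umbral 1) (of_nat (k - i)))"
    unfolding poly_umbral_tau_poly[OF assms] card_proper_colorings[OF assms]
    by (simp add: umbral_one sum_distrib_left mult_ac)
  then show "poly (umbral (tau_poly G)) (of_nat k)
      = poly (umbral (\<Sum>i\<le>card (pverts G). smult (surjective_weight G i) ((join_vertex ^^ i) 1))) (of_nat k)"
    unfolding poly_umbral_sum_join_vertex_funpow[symmetric] by (simp add: surjective_weight_def mult_ac)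
qed

lemma tau_poly_graph_join:
  assumes "pair_graph G" "pair_graph H" "pverts G \<inter> pverts H = {}"
  shows "tau_poly (graph_join G H)
    = (\<Sum>i\<le>card (pverts G). smult (surjective_weight G i) ((join_vertex ^^ i) (tau_poly H)))"
proof (rule umbral_eqI)
  fix k :: nat
  interpret G: pair_graph G by fact
  interpret H: pair_graph H by fact
  let ?a = "\<lambda>i. (-1) ^ card (pverts G) * real (card (onto_colorings G {..<i}))"
  have n: "card (pverts (graph_join G H)) = card (pverts G) + card (pverts H)"
    using assms(3) G.pair_finite_verts H.pair_finite_verts
    by (simp add: graph_join_def card_Un_disjoint)
  have "poly (umbral (tau_poly (graph_join G H))) (of_nat k)
      = (\<Sum>i\<le>card (pverts G). of_nat (k choose i) * ?a i * poly (umbral (tau_poly H)) (of_nat (k - i)))"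
    unfolding poly_umbral_tau_poly[OF pair_graph_graph_join[OF assms]] poly_umbral_tau_poly[OF assms(2)]
      card_proper_colorings_join[OF assms] n
    by (simp add: sum_distrib_left power_add mult_ac)
  then show "poly (umbral (tau_poly (graph_join G H))) (of_nat k)
      = poly (umbral (\<Sum>i\<le>card (pverts G). smult (surjective_weight G i)
          ((join_vertex ^^ i) (tau_poly H)))) (of_nat k)"
    unfolding poly_umbral_sum_join_vertex_funpow[symmetric] by (simp add: surjective_weight_def mult_ac)
qed

text \<open>
  The weight of \<open>0\<close> vanishes as \<open>G\<close> has a vertex, so only the positive powers of \<open>join_vertex\<close>
  occur, and for those \<open>sum_join_vertex_funpow\<close> converts the polynomial in \<open>join_vertex\<close> into the
  bilinear pairing.
\<close>

lemma tau_poly_join_laguerre_pairing: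
  assumes "pair_graph G" "pair_graph H" "pverts G \<inter> pverts H = {}" "pverts G \<noteq> {}"
    and p: "tau_poly G = [:0, 1:] * p" and q: "tau_poly H = [:0, 1:] * q"
  shows "tau_poly (graph_join G H) = [:0, 1:] * deriv_plus 1 (laguerre_pairing p q)"
proof -
  let ?n = "card (pverts G)" and ?w = "surjective_weight G"
  have "onto_colorings G {} = {}" using assms(4) by (auto simp: onto_colorings_def)
  then have w0: "?w 0 = 0" by (simp add: surjective_weight_def)
  have split: "(\<Sum>i\<le>?n. smult (?w i) (f i)) = (\<Sum>i=1..?n. smult (?w i) (f i))" for f :: "nat \<Rightarrow> real poly"
    by (rule sum.mono_neutral_right) (auto simp: w0 not_less_eq_eq)
  have "(\<Sum>i=1..?n. smult (?w i) ((join_vertex ^^ i) 1)) = [:0, 1:] * p"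
    using tau_poly_eq_sum_join_vertex[OF assms(1)] unfolding p split by (rule sym)
  from sum_join_vertex_funpow[OF this] show ?thesis
    unfolding tau_poly_graph_join[OF assms(1-3)] split q .
qed

section \<open>Joins preserve real-rootedness\<close>

abbreviation complex_poly :: "real poly \<Rightarrow> complex poly" where
  "complex_poly \<equiv> map_poly of_real"

lemma complex_poly_add: "complex_poly (p + q) = complex_poly p + complex_poly q"
  by (rule poly_eqI) (simp add: coeff_map_poly)

lemma complex_poly_smult: "complex_poly (smult c p) = smult (of_real c) (complex_poly p)"
  by (rule poly_eqI) (simp add: coeff_map_poly)

lemma complex_poly_mult: "complex_poly (p * q) = complex_poly p * complex_poly q"
  by (rule poly_eqI) (simp add: coeff_map_poly coeff_mult)

lemma complex_poly_pderiv: "complex_poly (pderiv p) = pderiv (complex_poly p)"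
  by (rule poly_eqI) (simp add: coeff_map_poly coeff_pderiv del: of_nat_Suc)

lemma complex_poly_monom: "complex_poly (monom c n) = monom (of_real c) n"
  by (simp add: map_poly_monom)

lemma degree_complex_poly: "degree (complex_poly p) = degree p"
  by (simp add: degree_map_poly)

lemma complex_poly_sum: "complex_poly (\<Sum>i\<in>I. f i) = (\<Sum>i\<in>I. complex_poly (f i))"
  by (induction I rule: infinite_finite_induct) (auto simp: complex_poly_add)

lemma complex_poly_deriv_plus: "complex_poly (deriv_plus c p) = deriv_plus (of_real c) (complex_poly p)"
  by (simp add: deriv_plus_def complex_poly_add complex_poly_smult complex_poly_pderiv)

lemma complex_poly_laguerre: "complex_poly (laguerre a b) = laguerre a b"
  unfolding laguerre_def by (induction b) (simp_all add: complex_poly_monom complex_poly_deriv_plus)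

lemma complex_poly_laguerre_pairing:
  "complex_poly (laguerre_pairing p q) = laguerre_pairing (complex_poly p) (complex_poly q)"
  by (simp add: laguerre_pairing_def linear_extension_def complex_poly_sum complex_poly_smult
      complex_poly_mult complex_poly_laguerre degree_complex_poly coeff_map_poly)

lemma poly_complex_poly_of_real: "poly (complex_poly p) (of_real x) = of_real (poly p x)"
  by (simp add: poly_altdef degree_complex_poly coeff_map_poly)

text \<open>
  The first assumption excludes \<open>p = 0\<close>, and a nonzero polynomial with nonnegative coefficients is positive
  on the positive reals.
\<close>

lemma nonneg_coeffs_zeros_nonpos:
  assumes "only_real_zeros ([:0, 1:] * p)" "\<And>i. coeff p i \<ge> 0" "poly (complex_poly p) z = 0"
  shows "z \<in> \<real>\<^sub>\<le>\<^sub>0"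
proof -
  have "p \<noteq> 0"
  proof
    assume "p = 0"
    then have "poly (complex_poly ([:0, 1:] * p)) \<i> = 0" by simp
    then have "\<i> \<in> \<real>" using assms(1) unfolding only_real_zeros_def by blast
    then show False by (simp add: complex_is_Real_iff)
  qed
  have "poly (complex_poly ([:0, 1:] * p)) z = 0"
    by (simp only: complex_poly_mult poly_mult assms(3) mult_zero_right)
  then have "z \<in> \<real>" using assms(1) unfolding only_real_zeros_def by blast
  then obtain r where r: "z = of_real r" by (rule Reals_cases)
  have "poly p r = 0" using assms(3) unfolding r poly_complex_poly_of_real by simp
  have "r \<le> 0"
  proof (rule ccontr)
    assume "\<not> r \<le> 0"
    moreover have "lead_coeff p > 0"
      using \<open>p \<noteq> 0\<close> by (intro order_le_neq_trans assms(2)) simp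
    ultimately have "0 < lead_coeff p * r ^ degree p" by simp
    also have "\<dots> \<le> poly p r"
      unfolding poly_altdef
    proof (rule member_le_sum)
      show "0 \<le> coeff p i * r ^ i" for i
        using assms(2)[of i] \<open>\<not> r \<le> 0\<close> by simp
    qed simp_all
    finally show False using \<open>poly p r = 0\<close> by simp
  qed
  then show ?thesis unfolding r by simp
qed

lemma graph_join_empty:
  assumes "pair_graph G" "pair_graph H"
  shows "pverts G = {} \<Longrightarrow> graph_join G H = H" and "pverts H = {} \<Longrightarrow> graph_join G H = G"
proof -
  have arcs: "parcs K = {}" if K: "pair_graph K" "pverts K = {}" for K :: "'a pair_pre_digraph"
  proof -
    interpret pair_graph K by fact
    show ?thesis using wellformed' K(2) by (metis empty_iff subrelI subset_empty)
  qed
  show "pverts G = {} \<Longrightarrow> graph_join G H = H" "pverts H = {} \<Longrightarrow> graph_join G H = G"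
    using arcs[OF assms(1)] arcs[OF assms(2)] by (simp_all add: graph_join_def)
qed

theorem theorem1p1:
  fixes G H :: "'a pair_pre_digraph"
  assumes "pair_graph G" and "pair_graph H"
    and "pverts G \<inter> pverts H = {}"
    and "only_real_zeros (tau_poly G)" and "only_real_zeros (tau_poly H)"
  shows "only_real_zeros (tau_poly (graph_join G H))"
proof (cases "pverts G = {} \<or> pverts H = {}")
  case True
  then show ?thesis using graph_join_empty[OF assms(1,2)] assms(4,5) by auto
next
  case False
  have factor: "\<exists>p. tau_poly K = [:0, 1:] * p \<and>
      (\<forall>z. poly (complex_poly p) z = 0 \<longrightarrow> z \<in> \<real>\<^sub>\<le>\<^sub>0)"
    if K: "pair_graph K" "pverts K \<noteq> {}" "only_real_zeros (tau_poly K)"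
    for K :: "'a pair_pre_digraph"
  proof -
    obtain c p where cp: "tau_poly K = pCons c p" by (metis pCons_cases)
    have "c = 0" using coeff_tau_poly_0[OF K(1,2)] by (simp add: cp)
    then have p: "tau_poly K = [:0, 1:] * p" by (simp add: cp)
    have "coeff p i \<ge> 0" for i
      using coeff_tau_poly_nonneg[OF K(1), of "Suc i"] unfolding cp by simp
    then show ?thesis
      using p nonneg_coeffs_zeros_nonpos[OF K(3)[unfolded p]] by blast
  qed
  from factor[OF assms(1) _ assms(4)] False obtain p where p: "tau_poly G = [:0, 1:] * p"
    "\<And>z. poly (complex_poly p) z = 0 \<Longrightarrow> z \<in> \<real>\<^sub>\<le>\<^sub>0" by blast
  from factor[OF assms(2) _ assms(5)] False obtain q where q: "tau_poly H = [:0, 1:] * q"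
    "\<And>z. poly (complex_poly q) z = 0 \<Longrightarrow> z \<in> \<real>\<^sub>\<le>\<^sub>0" by blast
  have \<tau>: "tau_poly (graph_join G H) = [:0, 1:] * deriv_plus 1 (laguerre_pairing p q)"
    using False by (intro tau_poly_join_laguerre_pairing assms(1-3) p(1) q(1)) simp
  show ?thesis
    unfolding only_real_zeros_def
  proof (intro allI impI)
    fix z :: complex
    assume z: "poly (complex_poly (tau_poly (graph_join G H))) z = 0"
    show "z \<in> \<real>"
    proof (rule ccontr)
      assume "z \<notin> \<real>"
      then have "z \<notin> \<real>\<^sub>\<le>\<^sub>0" "z \<noteq> 0" by auto
      then have "poly (deriv_plus 1 (laguerre_pairing (complex_poly p) (complex_poly q))) z \<noteq> 0"
        using deriv_plus_laguerre_pairing_nonvanishing[of "complex_poly p" "complex_poly q"] p(2) q(2)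
        by blast
      moreover have "poly (complex_poly [:0, 1:]) z = z" by (simp add: map_poly_pCons)
      ultimately show False
        using z \<open>z \<noteq> 0\<close> unfolding \<tau> complex_poly_mult complex_poly_deriv_plus complex_poly_laguerre_pairing
        by simp
    qed
  qed
qed

end
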